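(* Let $H$ be a looped simple graph and let $G$ be obtained from $H$ either by adding an edge or a loop, or by applying the $d$-dimensional $1$-extension operation. Suppose that $H$ can be realised in $\mathbb{R}^d$ as an infinitesimally rigid linearly constrained framework with a full rank equilibrium stress. Then $G$ can be realised in $\mathbb{R}^d$ as an infinitesimally rigid linearly constrained framework with a full rank equilibrium stress.
   Context: A looped simple graph $G=(V,E,L)$: $E$ is a set of non-loop edges with no parallel edges, $L$ a set of loops (several may be at one vertex). A $d$-dimensional linearly constrained framework (realisation of $G$) is $(G,p,q)$ with $p:V\to\mathbb{R}^d$, $q:L\to\mathbb{R}^d$. Its rigidity matrix $R(G,p,q)$ is the $(|E|+|L|)\times d|V|$ matrix whose row for $uv\in E$ has $p(u)-p(v)$ in the columns of $u$ and $p(v)-p(u)$ in the columns of $v$, and whose row for a loop $\ell$ at $v$ has $q(\ell)$ in the columns of $v$ (zeros elsewhere); the framework is infinitesimally rigid if this rank is $d|V|$. An equilibrium stress is $(\omega,\lambda)$, $\omega:E\to\mathbb{R}$, $\lambda:L\to\mathbb{R}$, in the cokernel of $R(G,p,q)$, i.e. for each vertex $v$, $\sum_{uv\in E}\omega(uv)(p(v)-p(u))+\sum_{\ell\text{ at }v}\lambda(\ell)q(\ell)=0$. Its stress matrix $\Omega(\omega)$ is the $|V|\times|V|$ matrix with $(u,v)$ entry $-\omega(uv)$ if $uv\in E$, $0$ for other $u\ne v$, and diagonal entry $\sum_{uv\in E}\omega(uv)$ at $v$; the stress is full rank if $\operatorname{rank}\Omega(\omega)=|V|-1$. The $d$-dimensional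 $1$-extension operation forms a new looped simple graph from $H$ by deleting an edge or loop $e$ and adding a new vertex $v$ together with $d+1$ new edges or loops incident to $v$, such that each end vertex of $e$ is incident to exactly one new edge, and, if $e$ is a loop, at least one new loop is incident to $v$.
   Formalization: The 1-extension of a graph H with a single vertex and exactly d loops is excluded: there the claim fails, since H has the zero stress of full rank 0, while a rigid G has 2d independent rows, so its only stress is zero, of rank 0 instead of 1. *)

theory Defs
  imports "HOL-Analysis.Analysis" "HOL-Library.Function_Algebras"
begin

(* Edges are two-element vertex sets, so parallel edges cannot occur. Loops are abstract
   objects attached to vertices by lvert, so a vertex may carry several loops; the values of
   lvert outside the loop set are irrelevant. *)
record ('v, 'l) looped_graph =
  verts :: "'v set"
  edges :: "'v set set"
  loops :: "'l set"
  lvert :: "'l \<Rightarrow> 'v"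

definition looped_simple_graph :: "('v, 'l) looped_graph \<Rightarrow> bool" where
  "looped_simple_graph G \<longleftrightarrow>
     finite (verts G) \<and> finite (loops G) \<and>
     (\<forall>e \<in> edges G. e \<subseteq> verts G \<and> card e = 2) \<and>
     (\<forall>l \<in> loops G. lvert G l \<in> verts G)"

lemma vector_space_fun: "vector_space (\<lambda>(a::real) (f :: 'c \<Rightarrow> real) x. a * f x)"
  by unfold_locales (auto simp: fun_eq_iff algebra_simps)

(* The rank of the matrix M with rows indexed by R and columns indexed by C: the dimension of
   its row space, each row being a function on the column index type that vanishes outside C. *)
definition matrix_rank :: "'r set \<Rightarrow> 'c set \<Rightarrow> ('r \<Rightarrow> 'c \<Rightarrow> real) \<Rightarrow> nat" where
  "matrix_rank R C M =
     vector_space.dim (\<lambda>(a::real) (f :: 'c \<Rightarrow> real) x. a * f x)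
       ((\<lambda>r c. if c \<in> C then M r c else 0) ` R)"

(* The column (x, i) is the i-th of the columns belonging to the vertex x. In the row of an
   edge e, the set e - {x} consists of just the other end of e. *)
fun rigidity_matrix ::
  "('v, 'l) looped_graph \<Rightarrow> ('v \<Rightarrow> real ^ 'd) \<Rightarrow> ('l \<Rightarrow> real ^ 'd) \<Rightarrow>
   'v set + 'l \<Rightarrow> 'v \<times> 'd \<Rightarrow> real" where
  "rigidity_matrix G p q (Inl e) (x, i) =
     (if x \<in> e then (\<Sum>y \<in> e - {x}. p x - p y) $ i else 0)"
| "rigidity_matrix G p q (Inr l) (x, i) = (if x = lvert G l then q l $ i else 0)"

definition infinitesimally_rigid ::
  "('v, 'l) looped_graph \<Rightarrow> ('v \<Rightarrow> real ^ 'd) \<Rightarrow> ('l \<Rightarrow> real ^ 'd) \<Rightarrow> bool" where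
  "infinitesimally_rigid G p q \<longleftrightarrow>
     matrix_rank (edges G <+> loops G) (verts G \<times> (UNIV :: 'd set)) (rigidity_matrix G p q)
       = CARD('d) * card (verts G)"

definition equilibrium_stress ::
  "('v, 'l) looped_graph \<Rightarrow> ('v \<Rightarrow> real ^ 'd) \<Rightarrow> ('l \<Rightarrow> real ^ 'd) \<Rightarrow>
   ('v set \<Rightarrow> real) \<Rightarrow> ('l \<Rightarrow> real) \<Rightarrow> bool" where
  "equilibrium_stress G p q \<omega> \<mu> \<longleftrightarrow>
     (\<forall>v \<in> verts G.
        (\<Sum>u | {u, v} \<in> edges G. \<omega> {u, v} *\<^sub>R (p v - p u)) +
        (\<Sum>l | l \<in> loops G \<and> lvert G l = v. \<mu> l *\<^sub>R q l) = 0)"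

lemma equilibrium_stress_iff_cokernel:
  fixes p :: "'v \<Rightarrow> real ^ 'd" and G :: "('v, 'l) looped_graph"
  assumes "looped_simple_graph G"
  shows "equilibrium_stress G p q \<omega> \<mu> \<longleftrightarrow>
    (\<forall>c \<in> verts G \<times> UNIV.
       (\<Sum>e \<in> edges G. \<omega> e * rigidity_matrix G p q (Inl e) c) +
       (\<Sum>l \<in> loops G. \<mu> l * rigidity_matrix G p q (Inr l) c) = 0)"
proof -
  have E: "e \<subseteq> verts G" "card e = 2" if "e \<in> edges G" for e
    using assms that by (auto simp: looped_simple_graph_def)
  have finV: "finite (verts G)" and finL: "finite (loops G)"
    using assms by (auto simp: looped_simple_graph_def)
  have finE: "finite (edges G)"
    using E(1) finV by (meson Pow_iff finite_Pow_iff finite_subset subsetI)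
  have nb: "u \<noteq> v" if "{u, v} \<in> edges G" for u v
    using E(2)[OF that] by auto
  have "(\<Sum>e \<in> edges G. \<omega> e * rigidity_matrix G p q (Inl e) (v, i)) =
        (\<Sum>u | {u, v} \<in> edges G. \<omega> {u, v} *\<^sub>R (p v - p u)) $ i" for v i
  proof -
    have "(\<Sum>e \<in> edges G. \<omega> e * rigidity_matrix G p q (Inl e) (v, i)) =
          (\<Sum>e | e \<in> edges G \<and> v \<in> e. \<omega> e * (\<Sum>y \<in> e - {v}. p v - p y) $ i)"
      using finE by (intro sum.mono_neutral_cong_right) auto
    also have "\<dots> = (\<Sum>u | {u, v} \<in> edges G. \<omega> {u, v} * (p v - p u) $ i)"
    proof (rule sum.reindex_cong[where l = "\<lambda>u. {u, v}"])
      show "inj_on (\<lambda>u. {u, v}) {u. {u, v} \<in> edges G}"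
        by (auto simp: inj_on_def doubleton_eq_iff)
      have "\<exists>w. e = {w, v}" if "e \<in> edges G" "v \<in> e" for e
        using E(2)[OF that(1)] that(2) by (auto simp: card_2_iff)
      then show "{e \<in> edges G. v \<in> e} = (\<lambda>u. {u, v}) ` {u. {u, v} \<in> edges G}"
        by fastforce
      show "\<omega> {u, v} * (\<Sum>y \<in> {u, v} - {v}. p v - p y) $ i = \<omega> {u, v} * (p v - p u) $ i"
        if "u \<in> {u. {u, v} \<in> edges G}" for u
      proof -
        have "{u, v} - {v} = {u}" using nb that by auto
        then show ?thesis by simp
      qed
    qed
    finally show ?thesis by simp
  qed
  moreover have "(\<Sum>l \<in> loops G. \<mu> l * rigidity_matrix G p q (Inr l) (v, i)) =
        (\<Sum>l | l \<in> loops G \<and> lvert G l = v. \<mu> l *\<^sub>R q l) $ i" for v i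
  proof -
    have "(\<Sum>l \<in> loops G. \<mu> l * rigidity_matrix G p q (Inr l) (v, i)) =
          (\<Sum>l | l \<in> loops G \<and> lvert G l = v. \<mu> l * q l $ i)"
      using finL by (intro sum.mono_neutral_cong_right) auto
    then show ?thesis by simp
  qed
  ultimately show ?thesis
    by (auto simp: equilibrium_stress_def vec_eq_iff)
qed

definition stress_matrix ::
  "('v, 'l) looped_graph \<Rightarrow> ('v set \<Rightarrow> real) \<Rightarrow> 'v \<Rightarrow> 'v \<Rightarrow> real" where
  "stress_matrix G \<omega> u v =
     (if u = v then (\<Sum>e | e \<in> edges G \<and> v \<in> e. \<omega> e)
      else if {u, v} \<in> edges G then - \<omega> {u, v} else 0)"

(* Written without the truncated subtraction card (verts G) - 1. *)
definition full_rank_stress :: "('v, 'l) looped_graph \<Rightarrow> ('v set \<Rightarrow> real) \<Rightarrow> bool" where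
  "full_rank_stress G \<omega> \<longleftrightarrow>
     matrix_rank (verts G) (verts G) (stress_matrix G \<omega>) + 1 = card (verts G)"

definition adds_edge :: "('v, 'l) looped_graph \<Rightarrow> ('v, 'l) looped_graph \<Rightarrow> bool" where
  "adds_edge H G \<longleftrightarrow>
     looped_simple_graph H \<and> looped_simple_graph G \<and>
     verts G = verts H \<and> (\<exists>e. e \<notin> edges H \<and> edges G = insert e (edges H)) \<and>
     loops G = loops H \<and> (\<forall>l \<in> loops H. lvert G l = lvert H l)"

definition adds_loop :: "('v, 'l) looped_graph \<Rightarrow> ('v, 'l) looped_graph \<Rightarrow> bool" where
  "adds_loop H G \<longleftrightarrow>
     looped_simple_graph H \<and> looped_simple_graph G \<and>
     verts G = verts H \<and> edges G = edges H \<and>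
     (\<exists>l. l \<notin> loops H \<and> loops G = insert l (loops H)) \<and>
     (\<forall>l \<in> loops H. lvert G l = lvert H l)"

(* v is the new vertex, F and N are the sets of new edges and new loops. In each case e is the
   deleted edge or loop; a deleted loop has the single end vertex lvert H e. *)
definition one_extension ::
  "nat \<Rightarrow> ('v, 'l) looped_graph \<Rightarrow> ('v, 'l) looped_graph \<Rightarrow> bool" where
  "one_extension d H G \<longleftrightarrow>
     looped_simple_graph H \<and> looped_simple_graph G \<and>
     (\<exists>v F N.
        v \<notin> verts H \<and> verts G = insert v (verts H) \<and>
        (\<forall>f \<in> F. v \<in> f) \<and> N \<inter> loops H = {} \<and> (\<forall>l \<in> N. lvert G l = v) \<and>
        card F + card N = d + 1 \<and>
        (\<forall>l \<in> loops G - N. lvert G l = lvert H l) \<and>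
        ((\<exists>e \<in> edges H.
            edges G = (edges H - {e}) \<union> F \<and> loops G = loops H \<union> N \<and>
            (\<forall>x \<in> e. \<exists>!f. f \<in> F \<and> x \<in> f)) \<or>
         (\<exists>e \<in> loops H.
            edges G = edges H \<union> F \<and> loops G = (loops H - {e}) \<union> N \<and>
            (\<exists>!f. f \<in> F \<and> lvert H e \<in> f) \<and> N \<noteq> {})))"

end

theory Submission imports Defs
begin

text \<open>
Call a realisation good if it is infinitesimally rigid and has a full rank equilibrium stress.
Rigidity means that the rigidity matrix has trivial kernel. Since its rank cannot drop under small
perturbations, a stress can be continued along any small perturbation of a good realisation, so being
good is an open condition.

The key point of the 1-extension is to make the stress nonzero on the deleted edge or loop \<open>i\<close>.
If every stress vanishes on \<open>i\<close>, then some \<open>m\<close> is mapped by the rigidity matrix to the unit vector at \<open>i\<close>.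
Move the realisation to \<open>(p + t w, q + t r)\<close>, with stresses \<open>s t\<close> continuing \<open>s\<close>. Pairing the equilibrium
equations with \<open>m\<close> gives \<open>s t i = - t D (s t)\<close>, where \<open>D (s t)\<close> is the pairing of \<open>s t\<close> and \<open>m\<close> for the
direction \<open>(w, r)\<close>. So we are done unless this pairing vanishes at \<open>s\<close> for all \<open>w\<close> and \<open>r\<close>. For \<open>r = 0\<close>
this says that the stress matrix kills \<open>m\<close>, so \<open>m\<close> is a translation \<open>c\<close>, \<open>i\<close> is a loop, and all other loop
vectors are orthogonal to \<open>c\<close>; then \<open>w = 0\<close> shows that the stress vanishes on all loops. Hence the stress
matrix kills \<open>p\<close> too, so all points coincide, and rigidity leaves a single vertex, whose loops are linearly
dependent outside the excluded case.

With a nonzero stress on the deleted edge or loop, the new vertex goes to the midpoint of the deleted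
edge, respectively to the tip of the deleted loop vector, after moving the neighbours into general position.
\<close>

section \<open>Kernels and cokernels of finite matrices\<close>

definition trivial_kernel :: "'r set \<Rightarrow> 'c set \<Rightarrow> ('r \<Rightarrow> 'c \<Rightarrow> real) \<Rightarrow> bool" where
  "trivial_kernel R C M \<longleftrightarrow>
     (\<forall>f. (\<forall>r\<in>R. (\<Sum>c\<in>C. M r c * f c) = 0) \<longrightarrow> (\<forall>c\<in>C. f c = 0))"

lemma trivial_kernelD:
  assumes "trivial_kernel R C M" "\<And>r. r \<in> R \<Longrightarrow> (\<Sum>c\<in>C. M r c * f c) = 0" "c \<in> C"
  shows "f c = 0"
  using assms by (auto simp: trivial_kernel_def)

interpretation fs: vector_space "\<lambda>(a::real) (f :: 'c \<Rightarrow> real) x. a * f x"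
  by (rule vector_space_fun)

text \<open>The second space is the real line, so that \<open>fsr\<close> supplies the linear
  functionals on the space of row functions.\<close>

interpretation fsr: vector_space_pair "\<lambda>(a::real) (f :: 'c \<Rightarrow> real) x. a * f x"
    "(*) :: real \<Rightarrow> real \<Rightarrow> real"
  by (intro vector_space_pair.intro vector_space_fun) (unfold_locales, auto simp: distrib_left distrib_right)

definition unit_fun :: "'c \<Rightarrow> 'c \<Rightarrow> real" where
  "unit_fun c = (\<lambda>x. if x = c then 1 else 0)"

lemma sum_unit_fun:
  assumes "finite C"
  shows "(\<Sum>c\<in>C. unit_fun a c * f c) = (if a \<in> C then f a else 0)"
    "(\<Sum>c\<in>C. f c * unit_fun a c) = (if a \<in> C then f a else 0)"
    "(\<Sum>c\<in>C. f c * unit_fun c a) = (if a \<in> C then f a else 0)"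
proof -
  have "unit_fun a c * f c = (if c = a then f c else 0)"
    "f c * unit_fun a c = (if c = a then f c else 0)"
    "f c * unit_fun c a = (if c = a then f c else 0)" for c
    by (auto simp: unit_fun_def)
  then show "(\<Sum>c\<in>C. unit_fun a c * f c) = (if a \<in> C then f a else 0)"
    "(\<Sum>c\<in>C. f c * unit_fun a c) = (if a \<in> C then f a else 0)"
    "(\<Sum>c\<in>C. f c * unit_fun c a) = (if a \<in> C then f a else 0)"
    using assms by (simp_all only: sum.delta)
qed

definition matrix_row :: "'c set \<Rightarrow> ('r \<Rightarrow> 'c \<Rightarrow> real) \<Rightarrow> 'r \<Rightarrow> 'c \<Rightarrow> real" where
  "matrix_row C M r = (\<lambda>c. if c \<in> C then M r c else 0)"

lemma sum_fun_apply: "(\<Sum>i\<in>I. f i) x = (\<Sum>i\<in>I. f i x)"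
  by (induction I rule: infinite_finite_induct) auto

lemma supported_fun_eq_sum:
  assumes "finite C" "\<And>x. x \<notin> C \<Longrightarrow> g x = 0"
  shows "g = (\<Sum>c\<in>C. (\<lambda>x. g c * unit_fun c x))"
  using assms by (auto simp: fun_eq_iff sum_fun_apply sum_unit_fun)

lemma independent_unit_funs:
  assumes "finite C"
  shows "fs.independent (unit_fun ` C)" "card (unit_fun ` C) = card C"
proof -
  have inj: "inj_on unit_fun C"
    by (rule inj_onI) (metis unit_fun_def zero_neq_one)
  then show "card (unit_fun ` C) = card C" by (rule card_image)
  show "fs.independent (unit_fun ` C)"
  proof (rule fs.independent_if_scalars_zero)
    fix a h
    assume z: "(\<Sum>h\<in>unit_fun ` C. (\<lambda>x. a h * h x)) = 0" and h: "h \<in> unit_fun ` C"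
    then obtain c where c: "c \<in> C" "h = unit_fun c" by auto
    have "(\<Sum>c\<in>C. (\<lambda>x. a (unit_fun c) * unit_fun c x)) = 0"
      using z inj by (simp add: sum.reindex)
    then have "(\<Sum>d\<in>C. a (unit_fun d) * unit_fun d c) = 0"
      by (simp add: fun_eq_iff sum_fun_apply)
    then show "a h = 0" using c assms by (simp add: sum_unit_fun)
  qed (use assms in auto)
qed

lemma span_unit_funs:
  assumes "finite C" "\<And>x. x \<notin> C \<Longrightarrow> g x = 0"
  shows "g \<in> fs.span (unit_fun ` C)"
proof -
  have "(\<Sum>c\<in>C. (\<lambda>x. g c * unit_fun c x)) \<in> fs.span (unit_fun ` C)"
    by (intro fs.span_sum fs.span_scale fs.span_base) auto
  then show ?thesis using supported_fun_eq_sum[OF assms] by simp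
qed

text \<open>Duality: if a unit function lay outside the row span, some linear functional would
  vanish on all rows and be 1 there. Its values on the unit functions would form a kernel vector
  with entry 1 at \<open>c\<close>.\<close>

lemma unit_fun_in_row_span:
  fixes M :: "'r \<Rightarrow> 'c \<Rightarrow> real"
  assumes "finite C" "trivial_kernel R C M" "c \<in> C"
  shows "unit_fun c \<in> fs.span (matrix_row C M ` R)"
proof (rule ccontr)
  let ?S = "matrix_row C M ` R"
  assume n: "unit_fun c \<notin> fs.span ?S"
  obtain B where B: "B \<subseteq> ?S" "fs.independent B" "?S \<subseteq> fs.span B"
    using fs.basis_exists[of ?S] by metis
  have sp: "fs.span B = fs.span ?S"
    using B by (simp add: fs.span_mono fs.span_minimal fs.subspace_span subset_antisym)
  have nB: "unit_fun c \<notin> B" using n B(1) fs.span_base by auto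
  have ind: "fs.independent (insert (unit_fun c) B)"
    using n B(2) sp by (simp add: fs.independent_insertI)
  obtain \<phi> where \<phi>: "Vector_Spaces.linear (\<lambda>(a::real) (f :: 'c \<Rightarrow> real) x. a * f x) (*) \<phi>"
     "\<forall>x\<in>insert (unit_fun c) B. \<phi> x = (if x = unit_fun c then 1 else 0)"
    using fsr.linear_independent_extend[OF ind, of "\<lambda>x. if x = unit_fun c then 1 else 0"] by blast
  interpret l: Vector_Spaces.linear "\<lambda>(a::real) (f :: 'c \<Rightarrow> real) x. a * f x" "(*)" \<phi>
    by (rule \<phi>(1))
  have z: "\<phi> x = 0" if "x \<in> ?S" for x
  proof -
    have "x \<in> fs.span B" using that B(3) by auto
    moreover have "\<phi> y = 0" if "y \<in> B" for y using \<phi>(2) nB that by auto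
    ultimately show ?thesis
      using fsr.linear_eq_0_on_span[OF \<phi>(1)] by blast
  qed
  have "(\<Sum>d\<in>C. M r d * \<phi> (unit_fun d)) = 0" if "r \<in> R" for r
  proof -
    have "matrix_row C M r = (\<Sum>d\<in>C. (\<lambda>x. matrix_row C M r d * unit_fun d x))"
      using assms(1) by (intro supported_fun_eq_sum) (auto simp: matrix_row_def)
    then have "\<phi> (matrix_row C M r) = \<phi> (\<Sum>d\<in>C. (\<lambda>x. matrix_row C M r d * unit_fun d x))"
      by (rule arg_cong)
    also have "\<dots> = (\<Sum>d\<in>C. matrix_row C M r d * \<phi> (unit_fun d))"
      by (simp only: l.sum l.scale)
    also have "\<dots> = (\<Sum>d\<in>C. M r d * \<phi> (unit_fun d))"
      by (intro sum.cong) (auto simp: matrix_row_def)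
    finally show ?thesis using z that by simp
  qed
  then have "\<phi> (unit_fun c) = 0"
    using trivial_kernelD[OF assms(2), where f = "\<lambda>d. \<phi> (unit_fun d)"] assms(3) by blast
  then show False using \<phi>(2) by simp
qed

text \<open>The coefficients that write the unit functions as combinations of rows are the rows of
  the left inverse.\<close>

lemma left_inverse_exists:
  assumes "finite R" "finite C" "trivial_kernel R C M"
  shows "\<exists>L. \<forall>c\<in>C. \<forall>d\<in>C. (\<Sum>r\<in>R. L c r * M r d) = unit_fun c d"
proof -
  \<comment> \<open>The combinations are indexed by \<open>R\<close> itself, since the span of the
    image merges indices whose rows are equal.\<close>
  let ?T = "{g. \<exists>a. g = (\<lambda>x. \<Sum>r\<in>R. a r * matrix_row C M r x)}"
  have sub: "fs.subspace ?T"
  proof (rule fs.subspaceI)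
    show "0 \<in> ?T" by (auto simp: fun_eq_iff intro!: exI[of _ "\<lambda>_. 0"])
    fix x y c assume "x \<in> ?T"
    then obtain a where a: "x = (\<lambda>x. \<Sum>r\<in>R. a r * matrix_row C M r x)" by auto
    show "(\<lambda>u. c * x u) \<in> ?T"
      unfolding a by (auto simp: sum_distrib_left mult.assoc intro!: exI[of _ "\<lambda>r. c * a r"])
    assume "y \<in> ?T"
    then obtain b where b: "y = (\<lambda>x. \<Sum>r\<in>R. b r * matrix_row C M r x)" by auto
    show "x + y \<in> ?T"
      unfolding a b by (auto simp: fun_eq_iff sum.distrib distrib_right intro!: exI[of _ "\<lambda>r. a r + b r"])
  qed
  have "matrix_row C M r \<in> ?T" if "r \<in> R" for r
    using that assms(1)
    by (auto simp: fun_eq_iff sum_unit_fun intro!: exI[of _ "unit_fun r"])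
  then have "fs.span (matrix_row C M ` R) \<subseteq> ?T"
    using sub by (intro fs.span_minimal) auto
  then have "\<exists>a. unit_fun c = (\<lambda>x. \<Sum>r\<in>R. a r * matrix_row C M r x)" if "c \<in> C" for c
    using unit_fun_in_row_span[OF assms(2,3) that] by auto
  then obtain L where "\<And>c. c \<in> C \<Longrightarrow> unit_fun c = (\<lambda>x. \<Sum>r\<in>R. L c r * matrix_row C M r x)"
    by metis
  then have "(\<Sum>r\<in>R. L c r * M r d) = unit_fun c d" if "c \<in> C" "d \<in> C" for c d
    using that by (simp add: matrix_row_def)
  then show ?thesis by blast
qed

lemma dim_insert_outside_span:
  assumes "finite S" "x \<notin> fs.span S"
  shows "fs.dim (insert x S) = fs.dim S + 1"
proof -
  obtain B where B: "B \<subseteq> S" "fs.independent B" "S \<subseteq> fs.span B" "card B = fs.dim S"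
    using fs.basis_exists[of S] by metis
  have sp: "fs.span B = fs.span S"
    using B by (simp add: fs.span_mono fs.span_minimal fs.subspace_span subset_antisym)
  have fin: "finite B" using B(1) assms(1) finite_subset by auto
  have nB: "x \<notin> B" using assms(2) B(1) fs.span_base by auto
  have ind: "fs.independent (insert x B)"
    using assms(2) B(2) sp by (simp add: fs.independent_insertI)
  have "fs.dim (insert x S) = card (insert x B)"
  proof (rule fs.dim_unique)
    show "insert x B \<subseteq> insert x S" using B by auto
    have "fs.span B \<subseteq> fs.span (insert x B)" by (rule fs.span_mono) auto
    then show "insert x S \<subseteq> fs.span (insert x B)"
      using B(3) fs.span_base[of x "insert x B"] by auto
  qed (use ind in auto)
  then show ?thesis using nB fin B(4) by simp
qed

section \<open>Full rank and corank one as kernel conditions\<close>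

lemma matrix_rank_eq_dim: "matrix_rank R C M = fs.dim (matrix_row C M ` R)"
  by (simp add: matrix_rank_def matrix_row_def)

text \<open>All rows lie in the span of the \<open>card C\<close> unit functions. If the rank is
  \<open>card C\<close>, a basis chosen among the rows already spans the unit functions, by
  exchange, so a vector killed by all rows has every entry zero. Conversely a trivial kernel makes
  the two spans equal.\<close>

lemma matrix_rank_full_iff:
  assumes "finite C"
  shows "matrix_rank R C M = card C \<longleftrightarrow> trivial_kernel R C M"
proof
  let ?S = "matrix_row C M ` R" and ?D = "unit_fun ` C"
  have SD: "?S \<subseteq> fs.span ?D"
    using assms by (auto intro!: span_unit_funs simp: matrix_row_def)
  {
    assume r: "matrix_rank R C M = card C"
    obtain B where B: "B \<subseteq> ?S" "fs.independent B" "?S \<subseteq> fs.span B" "card B = fs.dim ?S"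
      using fs.basis_exists[of ?S] by metis
    have cB: "card B = card ?D"
      using B r independent_unit_funs[OF assms] by (simp add: matrix_rank_eq_dim)
    have finB: "finite B"
      using fs.independent_span_bound[of ?D B] B(1,2) SD assms by auto
    have "?D \<subseteq> fs.span B"
    proof
      fix x assume x: "x \<in> ?D"
      show "x \<in> fs.span B"
      proof (rule ccontr)
        assume n: "x \<notin> fs.span B"
        then have "fs.independent (insert x B)" using B(2) by (simp add: fs.independent_insertI)
        moreover have "insert x B \<subseteq> fs.span ?D" using x B(1) SD fs.span_superset[of ?D] by blast
        ultimately have "card (insert x B) \<le> card ?D"
          using fs.independent_span_bound[of ?D "insert x B"] assms by auto
        moreover have "x \<notin> B" using n fs.span_base by auto
        ultimately show False using finB cB by simp
      qed
    qed
    then have D: "?D \<subseteq> fs.span ?S"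
      using B(1) fs.span_mono by blast
    show "trivial_kernel R C M"
      unfolding trivial_kernel_def
    proof (intro allI impI ballI)
      fix f c assume k: "\<forall>r\<in>R. (\<Sum>c\<in>C. M r c * f c) = 0" and c: "c \<in> C"
      let ?K = "{g. (\<Sum>c\<in>C. g c * f c) = 0}"
      have "fs.subspace ?K"
        by (rule fs.subspaceI) (auto simp: distrib_right sum.distrib mult.assoc simp flip: sum_distrib_left)
      moreover have "?S \<subseteq> ?K" using k by (auto simp: matrix_row_def)
      ultimately have "fs.span ?S \<subseteq> ?K" by (intro fs.span_minimal)
      then have "unit_fun c \<in> ?K" using D c by auto
      then show "f c = 0" using c assms by (simp add: sum_unit_fun)
    qed
  }
  {
    assume k: "trivial_kernel R C M"
    have "?D \<subseteq> fs.span ?S" using unit_fun_in_row_span[OF assms k] by auto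
    then have "fs.span ?S = fs.span ?D"
      using SD by (simp add: fs.span_eq)
    then show "matrix_rank R C M = card C"
      using independent_unit_funs[OF assms]
      by (metis fs.dim_span fs.dim_eq_card_independent matrix_rank_eq_dim)
  }
qed

text \<open>Corank one becomes a full rank condition after adding a unit row, which is independent of the
rows with sum zero.\<close>

lemma matrix_rank_corank_one_iff:
  assumes "finite R" "finite C" "c0 \<in> C" "\<And>r. r \<in> R \<Longrightarrow> (\<Sum>c\<in>C. M r c) = 0"
  shows "matrix_rank R C M + 1 = card C \<longleftrightarrow>
    trivial_kernel (insert None (Some ` R)) C (case_option (unit_fun c0) M)"
proof -
  let ?S = "matrix_row C M ` R"
  let ?K = "{g. (\<Sum>c\<in>C. g c) = 0}"
  have "fs.subspace ?K"
    by (rule fs.subspaceI) (auto simp: sum.distrib simp flip: sum_distrib_left)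
  moreover have "?S \<subseteq> ?K" using assms(4) by (auto simp: matrix_row_def)
  ultimately have "fs.span ?S \<subseteq> ?K" by (intro fs.span_minimal)
  moreover have "unit_fun c0 \<notin> ?K"
    using assms(2,3) by (simp add: unit_fun_def)
  ultimately have "unit_fun c0 \<notin> fs.span ?S" by auto
  then have "fs.dim (insert (unit_fun c0) ?S) = fs.dim ?S + 1"
    using assms(1) by (intro dim_insert_outside_span) auto
  moreover have "matrix_row C (case_option (unit_fun c0) M) ` (insert None (Some ` R)) =
      insert (unit_fun c0) ?S"
    using assms(3) by (auto simp: matrix_row_def fun_eq_iff unit_fun_def image_image)
  ultimately have "matrix_rank R C M + 1 =
      matrix_rank (insert None (Some ` R)) C (case_option (unit_fun c0) M)"
    by (simp add: matrix_rank_eq_dim)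
  then show ?thesis using matrix_rank_full_iff[OF assms(2)] by metis
qed

section \<open>Stability of injectivity and of cokernel vectors\<close>

text \<open>The operator \<open>D\<close> at most halves the l1 norm, so the norm of
  \<open>u\<close> is at most that of \<open>g\<close> plus half of its own. With
  \<open>g = 0\<close> this gives injectivity of the identity plus \<open>D\<close>; with
  \<open>D\<close> transposed it bounds solutions of the adjoint equation.\<close>

lemma l1_contraction_bound:
  fixes u g :: "'c \<Rightarrow> real" and \<epsilon> :: real
  assumes "finite C" "\<And>c. c \<in> C \<Longrightarrow> u c = g c - (\<Sum>b\<in>C. D c b * u b)"
    and "\<And>c b. c \<in> C \<Longrightarrow> b \<in> C \<Longrightarrow> \<bar>D c b\<bar> \<le> \<epsilon>" "card C * \<epsilon> \<le> 1 / 2"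
  shows "(\<Sum>c\<in>C. \<bar>u c\<bar>) \<le> 2 * (\<Sum>c\<in>C. \<bar>g c\<bar>)"
proof -
  have "\<bar>u c\<bar> \<le> \<bar>g c\<bar> + \<epsilon> * (\<Sum>b\<in>C. \<bar>u b\<bar>)" if c: "c \<in> C" for c
  proof -
    have "\<bar>\<Sum>b\<in>C. D c b * u b\<bar> \<le> (\<Sum>b\<in>C. \<bar>D c b * u b\<bar>)" by (rule sum_abs)
    also have "\<dots> \<le> (\<Sum>b\<in>C. \<epsilon> * \<bar>u b\<bar>)"
      using assms(3) c by (intro sum_mono) (auto simp: abs_mult intro: mult_right_mono)
    finally show ?thesis using assms(2)[OF c] by (simp add: sum_distrib_left)
  qed
  then have "(\<Sum>c\<in>C. \<bar>u c\<bar>) \<le> (\<Sum>c\<in>C. \<bar>g c\<bar> + \<epsilon> * (\<Sum>b\<in>C. \<bar>u b\<bar>))"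
    by (rule sum_mono)
  also have "\<dots> = (\<Sum>c\<in>C. \<bar>g c\<bar>) + (card C * \<epsilon>) * (\<Sum>b\<in>C. \<bar>u b\<bar>)"
    by (simp add: sum.distrib)
  also have "\<dots> \<le> (\<Sum>c\<in>C. \<bar>g c\<bar>) + 1 / 2 * (\<Sum>b\<in>C. \<bar>u b\<bar>)"
    using assms(4) by (intro add_left_mono mult_right_mono) (auto simp: sum_nonneg)
  finally show ?thesis by simp
qed

lemma abs_sum_mult_le:
  fixes a b :: "'r \<Rightarrow> real" and A B :: real
  assumes "\<And>r. r \<in> R \<Longrightarrow> \<bar>a r\<bar> \<le> A" "\<And>r. r \<in> R \<Longrightarrow> \<bar>b r\<bar> \<le> B"
  shows "\<bar>\<Sum>r\<in>R. a r * b r\<bar> \<le> card R * (A * B)"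
proof -
  have "\<bar>\<Sum>r\<in>R. a r * b r\<bar> \<le> (\<Sum>r\<in>R. \<bar>a r * b r\<bar>)" by (rule sum_abs)
  also have "\<dots> \<le> (\<Sum>r\<in>R. A * B)"
    using assms by (intro sum_mono) (auto simp: abs_mult intro!: mult_mono intro: order_trans[OF abs_ge_zero])
  finally show ?thesis by simp
qed

lemma finite_abs_bound:
  assumes "finite A"
  obtains K where "K > 0" "\<And>x. x \<in> A \<Longrightarrow> \<bar>f x :: real\<bar> \<le> K"
proof
  show "0 < 1 + (\<Sum>x\<in>A. \<bar>f x\<bar>)" by (simp add: add_pos_nonneg sum_nonneg)
  show "\<bar>f x\<bar> \<le> 1 + (\<Sum>x\<in>A. \<bar>f x\<bar>)" if "x \<in> A" for x
    using member_le_sum[OF that, of "\<lambda>x. \<bar>f x\<bar>"] assms by simp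
qed

text \<open>A left inverse \<open>L\<close> of \<open>M\<close> gives a square matrix \<open>L M' = I + D\<close> with \<open>D\<close> small, which is inverted by
contraction in the \<open>l\<^sup>1\<close> norm.\<close>

lemma trivial_kernel_perturb:
  fixes M :: "'r \<Rightarrow> 'c \<Rightarrow> real"
  assumes "finite R" "finite C" "trivial_kernel R C M"
  shows "\<exists>\<delta>>0. \<exists>K>0. \<forall>M'. (\<forall>r\<in>R. \<forall>c\<in>C. \<bar>M' r c - M r c\<bar> \<le> \<delta>) \<longrightarrow>
       trivial_kernel R C M' \<and>
       (\<forall>g. \<exists>s. (\<forall>c\<in>C. (\<Sum>r\<in>R. s r * M' r c) = g c) \<and>
                (\<forall>r\<in>R. \<bar>s r\<bar> \<le> K * (\<Sum>c\<in>C. \<bar>g c\<bar>)))"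
proof -
  obtain L where L: "\<And>c d. c \<in> C \<Longrightarrow> d \<in> C \<Longrightarrow> (\<Sum>r\<in>R. L c r * M r d) = unit_fun c d"
    using left_inverse_exists[OF assms] by blast
  obtain K where K: "K > 0" "\<And>c r. c \<in> C \<Longrightarrow> r \<in> R \<Longrightarrow> \<bar>L c r\<bar> \<le> K"
  proof -
    obtain K where "K > 0" "\<And>x. x \<in> C \<times> R \<Longrightarrow> \<bar>L (fst x) (snd x)\<bar> \<le> K"
      using finite_abs_bound[of "C \<times> R" "\<lambda>x. L (fst x) (snd x)"] assms by blast
    then show ?thesis using that[of K] by force
  qed
  \<comment> \<open>This makes \<open>card R * K * \<delta>\<close> at most
    \<open>1 / (2 * card C)\<close>; the added ones keep the denominator positive when an index set
    is empty.\<close>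
  define \<delta> where "\<delta> = 1 / (2 * (real (card C) + 1) * (real (card R) + 1) * K)"
  have \<delta>: "\<delta> > 0" using K by (simp add: \<delta>_def)
  define \<epsilon> where "\<epsilon> = card R * (K * \<delta>)"
  have eps: "card C * \<epsilon> \<le> 1 / 2"
  proof -
    let ?N = "(real (card C) + 1) * (real (card R) + 1)"
    have N: "?N > 0" by (intro mult_pos_pos) auto
    have "real (card C) * real (card R) \<le> ?N"
      by (simp add: algebra_simps)
    then have "real (card C) * real (card R) / ?N \<le> 1" using N by (simp only: divide_le_eq_1_pos)
    moreover have "card C * \<epsilon> = real (card C) * real (card R) / ?N / 2"
      using K by (simp add: \<epsilon>_def \<delta>_def)
    ultimately show ?thesis by simp
  qed
  show ?thesis
  proof (rule exI[of _ \<delta>], intro conjI exI[of _ "2 * K"] allI impI)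
    fix M' assume close: "\<forall>r\<in>R. \<forall>c\<in>C. \<bar>M' r c - M r c\<bar> \<le> \<delta>"
    define D where "D c d = (\<Sum>r\<in>R. L c r * (M' r d - M r d))" for c d
    have LM': "(\<Sum>r\<in>R. L c r * M' r d) = unit_fun c d + D c d" if "c \<in> C" "d \<in> C" for c d
      using L[OF that] by (simp add: D_def right_diff_distrib sum_subtractf)
    have D: "\<bar>D c d\<bar> \<le> \<epsilon>" if "c \<in> C" "d \<in> C" for c d
      unfolding D_def \<epsilon>_def using that K close by (intro abs_sum_mult_le) auto
    have square: "trivial_kernel C C (\<lambda>c d. unit_fun c d + D c d)"
      unfolding trivial_kernel_def
    proof (intro allI impI)
      fix f assume z: "\<forall>c\<in>C. (\<Sum>d\<in>C. (unit_fun c d + D c d) * f d) = 0"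
      have "f c = 0 - (\<Sum>d\<in>C. D c d * f d)" if "c \<in> C" for c
        using z that assms(2) by (simp add: distrib_right sum.distrib sum_unit_fun eq_neg_iff_add_eq_0)
      then have "(\<Sum>c\<in>C. \<bar>f c\<bar>) \<le> 2 * (\<Sum>c\<in>C. \<bar>0::real\<bar>)"
        using D eps assms(2) by (intro l1_contraction_bound[of C f "\<lambda>_. 0" D \<epsilon>]) auto
      then have "(\<Sum>c\<in>C. \<bar>f c\<bar>) = 0" by (simp add: sum_nonneg antisym)
      then show "\<forall>c\<in>C. f c = 0" using assms(2) by (simp add: sum_nonneg_eq_0_iff)
    qed
    show "trivial_kernel R C M'"
      unfolding trivial_kernel_def
    proof (intro allI impI)
      fix f assume z: "\<forall>r\<in>R. (\<Sum>c\<in>C. M' r c * f c) = 0"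
      have "(\<Sum>d\<in>C. (unit_fun c d + D c d) * f d) = 0" if c: "c \<in> C" for c
      proof -
        have "(\<Sum>d\<in>C. (unit_fun c d + D c d) * f d) = (\<Sum>d\<in>C. (\<Sum>r\<in>R. L c r * M' r d) * f d)"
          using LM' c by (intro sum.cong) auto
        also have "\<dots> = (\<Sum>r\<in>R. L c r * (\<Sum>d\<in>C. M' r d * f d))"
          unfolding sum_distrib_left sum_distrib_right mult.assoc by (rule sum.swap)
        finally show ?thesis using z by simp
      qed
      then show "\<forall>c\<in>C. f c = 0" using square by (auto simp: trivial_kernel_def)
    qed
    show "\<exists>s. (\<forall>c\<in>C. (\<Sum>r\<in>R. s r * M' r c) = g c) \<and>
                (\<forall>r\<in>R. \<bar>s r\<bar> \<le> 2 * K * (\<Sum>c\<in>C. \<bar>g c\<bar>))" for g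
    proof -
      \<comment> \<open>A left inverse \<open>X\<close> of the square matrix \<open>I + D\<close>
        gives the solution \<open>u = g X\<close> of \<open>u (I + D) = g\<close>.\<close>
      obtain X where X: "\<And>c d. c \<in> C \<Longrightarrow> d \<in> C \<Longrightarrow>
          (\<Sum>b\<in>C. X c b * (unit_fun b d + D b d)) = unit_fun c d"
        using left_inverse_exists[OF assms(2,2) square] by blast
      define u where "u b = (\<Sum>c\<in>C. g c * X c b)" for b
      have u: "(\<Sum>b\<in>C. u b * (unit_fun b d + D b d)) = g d" if "d \<in> C" for d
      proof -
        have "(\<Sum>b\<in>C. u b * (unit_fun b d + D b d)) =
            (\<Sum>c\<in>C. g c * (\<Sum>b\<in>C. X c b * (unit_fun b d + D b d)))"
          unfolding u_def sum_distrib_left sum_distrib_right mult.assoc by (rule sum.swap)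
        also have "\<dots> = (\<Sum>c\<in>C. g c * unit_fun c d)" using X that by (intro sum.cong) auto
        finally show ?thesis using that assms(2) by (simp add: sum_unit_fun)
      qed
      have "u d = g d - (\<Sum>b\<in>C. D b d * u b)" if "d \<in> C" for d
        using u[OF that] that assms(2)
        by (simp add: distrib_left sum.distrib sum_unit_fun mult.commute eq_diff_eq)
      then have ub: "(\<Sum>c\<in>C. \<bar>u c\<bar>) \<le> 2 * (\<Sum>c\<in>C. \<bar>g c\<bar>)"
        using D eps assms(2) by (intro l1_contraction_bound[of C u g "\<lambda>c b. D b c" \<epsilon>]) auto
      \<comment> \<open>In matrix notation \<open>s = u L\<close>, hence
        \<open>s M' = u (L M') = u (I + D) = g\<close>.\<close>
      let ?s = "\<lambda>r. \<Sum>b\<in>C. u b * L b r"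
      have "(\<Sum>r\<in>R. ?s r * M' r c) = g c" if "c \<in> C" for c
      proof -
        have "(\<Sum>r\<in>R. ?s r * M' r c) = (\<Sum>b\<in>C. u b * (\<Sum>r\<in>R. L b r * M' r c))"
          unfolding sum_distrib_left sum_distrib_right mult.assoc by (rule sum.swap)
        also have "\<dots> = (\<Sum>b\<in>C. u b * (unit_fun b c + D b c))"
          using LM' that by (intro sum.cong) auto
        finally show ?thesis using u that by simp
      qed
      moreover have "\<bar>?s r\<bar> \<le> 2 * K * (\<Sum>c\<in>C. \<bar>g c\<bar>)" if "r \<in> R" for r
      proof -
        have "\<bar>?s r\<bar> \<le> (\<Sum>b\<in>C. \<bar>u b * L b r\<bar>)" by (rule sum_abs)
        also have "\<dots> \<le> (\<Sum>b\<in>C. \<bar>u b\<bar> * K)"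
          using K that by (intro sum_mono) (auto simp: abs_mult intro: mult_left_mono)
        also have "\<dots> = K * (\<Sum>c\<in>C. \<bar>u c\<bar>)" by (simp add: sum_distrib_left mult.commute)
        also have "\<dots> \<le> K * (2 * (\<Sum>c\<in>C. \<bar>g c\<bar>))" using ub K by (intro mult_left_mono) auto
        finally show ?thesis by simp
      qed
      ultimately show ?thesis by (intro exI[of _ ?s]) blast
    qed
  qed (use \<delta> K in auto)
qed

text \<open>The old cokernel vector has the small defect \<open>s M' = s (M' - M)\<close>. The
  preceding lemma solves \<open>h M'\<close> = defect with a bound on \<open>h\<close> that is
  uniform in \<open>M'\<close>, and \<open>s - h\<close> is the continued cokernel vector.\<close>

lemma cokernel_perturb:
  fixes M :: "'r \<Rightarrow> 'c \<Rightarrow> real"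
  assumes "finite R" "finite C" "trivial_kernel R C M"
    and s: "\<And>c. c \<in> C \<Longrightarrow> (\<Sum>r\<in>R. s r * M r c) = 0" and "\<epsilon> > 0"
  shows "\<exists>\<delta>>0. \<forall>M'. (\<forall>r\<in>R. \<forall>c\<in>C. \<bar>M' r c - M r c\<bar> \<le> \<delta>) \<longrightarrow>
       trivial_kernel R C M' \<and>
       (\<exists>s'. (\<forall>c\<in>C. (\<Sum>r\<in>R. s' r * M' r c) = 0) \<and> (\<forall>r\<in>R. \<bar>s' r - s r\<bar> \<le> \<epsilon>))"
proof -
  obtain \<delta>0 K where K: "\<delta>0 > 0" "K > 0"
    and pert: "\<And>M'. (\<forall>r\<in>R. \<forall>c\<in>C. \<bar>M' r c - M r c\<bar> \<le> \<delta>0) \<Longrightarrow>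
       trivial_kernel R C M' \<and>
       (\<forall>g. \<exists>s. (\<forall>c\<in>C. (\<Sum>r\<in>R. s r * M' r c) = g c) \<and>
                (\<forall>r\<in>R. \<bar>s r\<bar> \<le> K * (\<Sum>c\<in>C. \<bar>g c\<bar>)))"
    using trivial_kernel_perturb[OF assms(1-3)] by blast
  obtain A where A: "A > 0" "\<And>r. r \<in> R \<Longrightarrow> \<bar>s r\<bar> \<le> A"
    using finite_abs_bound[OF assms(1)] by metis
  \<comment> \<open>\<open>Q\<close> dominates all factors lost on the way from the size of
    \<open>M' - M\<close> to the size of \<open>h\<close>, so a perturbation below
    \<open>\<epsilon> / Q\<close> changes the vector by at most \<open>\<epsilon>\<close>.\<close>
  define Q where "Q = (real (card C) + 1) * (real (card R) + 1) * K * A"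
  have Q: "Q > 0" using K A unfolding Q_def by (intro mult_pos_pos add_nonneg_pos) auto
  show ?thesis
  proof (rule exI[of _ "min \<delta>0 (\<epsilon> / Q)"], intro conjI allI impI)
    show "0 < min \<delta>0 (\<epsilon> / Q)" using K Q \<open>\<epsilon> > 0\<close> by simp
    fix M' assume close: "\<forall>r\<in>R. \<forall>c\<in>C. \<bar>M' r c - M r c\<bar> \<le> min \<delta>0 (\<epsilon> / Q)"
    define g where "g c = (\<Sum>r\<in>R. s r * M' r c)" for c
    show "trivial_kernel R C M'" using pert close by fastforce
    obtain h where h: "\<And>c. c \<in> C \<Longrightarrow> (\<Sum>r\<in>R. h r * M' r c) = g c"
        "\<And>r. r \<in> R \<Longrightarrow> \<bar>h r\<bar> \<le> K * (\<Sum>c\<in>C. \<bar>g c\<bar>)"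
      using pert[of M'] close by fastforce
    have "\<bar>g c\<bar> \<le> card R * (A * (\<epsilon> / Q))" if "c \<in> C" for c
    proof -
      have "g c = (\<Sum>r\<in>R. s r * (M' r c - M r c))"
        using s[OF that] by (simp add: g_def right_diff_distrib sum_subtractf)
      also have "\<bar>\<dots>\<bar> \<le> card R * (A * (\<epsilon> / Q))"
        using A close that by (intro abs_sum_mult_le) fastforce+
      finally show ?thesis .
    qed
    then have "(\<Sum>c\<in>C. \<bar>g c\<bar>) \<le> card C * (card R * (A * (\<epsilon> / Q)))"
      by (intro sum_bounded_above)
    then have "K * (\<Sum>c\<in>C. \<bar>g c\<bar>) \<le> K * (card C * (card R * (A * (\<epsilon> / Q))))"
      using K by (intro mult_left_mono) auto
    also have "\<dots> = (card C * card R * K * A) * \<epsilon> / Q" by simp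
    also have "\<dots> \<le> Q * \<epsilon> / Q"
    proof -
      have "real (card C) * real (card R) \<le> (real (card C) + 1) * (real (card R) + 1)"
        by (simp add: algebra_simps)
      then have "card C * card R * K * A \<le> Q"
        using K A unfolding Q_def by (intro mult_right_mono) auto
      then show ?thesis using \<open>\<epsilon> > 0\<close> Q by (intro divide_right_mono mult_right_mono) auto
    qed
    also have "\<dots> = \<epsilon>" using Q by simp
    finally have "\<And>r. r \<in> R \<Longrightarrow> \<bar>h r\<bar> \<le> \<epsilon>" using h(2) by fastforce
    moreover have "(\<Sum>r\<in>R. (s r - h r) * M' r c) = 0" if "c \<in> C" for c
      using h(1)[OF that] by (simp add: g_def left_diff_distrib sum_subtractf)
    ultimately show "\<exists>s'. (\<forall>c\<in>C. (\<Sum>r\<in>R. s' r * M' r c) = 0) \<and> (\<forall>r\<in>R. \<bar>s' r - s r\<bar> \<le> \<epsilon>)"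
      by (intro exI[of _ "\<lambda>r. s r - h r"]) auto
  qed
qed

section \<open>Weak forms of rigidity and stress conditions\<close>

text \<open>Summing over ordered pairs avoids choosing an order of the two ends, and the division by
  2 undoes the double count. With vectors as values this is a row of the rigidity matrix applied to
  \<open>m\<close>; with real values it is the Laplacian form of one edge.\<close>

definition edge_form :: "('v \<Rightarrow> 'a::real_inner) \<Rightarrow> ('v \<Rightarrow> 'a) \<Rightarrow> 'v set \<Rightarrow> real" where
  "edge_form p m e = (\<Sum>x\<in>e. \<Sum>y\<in>e. (p x - p y) \<bullet> (m x - m y)) / 2"

lemma edge_form_doubleton:
  "edge_form p m {x, y} = (p x - p y) \<bullet> (m x - m y)"
proof (cases "x = y")
  case False
  have "(p y - p x) \<bullet> (m y - m x) = (p x - p y) \<bullet> (m x - m y)"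
    by (simp add: inner_diff_left inner_diff_right)
  then show ?thesis using False by (simp add: edge_form_def)
qed (simp add: edge_form_def)

lemma edge_form_add_left: "edge_form (\<lambda>x. p x + p' x) m e = edge_form p m e + edge_form p' m e"
proof -
  have "(p x + p' x - (p y + p' y)) \<bullet> (m x - m y)
      = (p x - p y) \<bullet> (m x - m y) + (p' x - p' y) \<bullet> (m x - m y)" for x y
    by (simp add: algebra_simps inner_add_left inner_add_right inner_diff_left inner_diff_right)
  then show ?thesis by (simp add: edge_form_def sum.distrib add_divide_distrib)
qed

lemma edge_form_scale_left: "edge_form (\<lambda>x. a *\<^sub>R p x) m e = a * edge_form p m e"
  by (simp add: edge_form_def sum_distrib_left mult.assoc flip: scaleR_diff_right)

lemma edge_form_commute: "edge_form p m e = edge_form m p e"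
  by (simp add: edge_form_def inner_commute)

lemma edge_form_cong:
  assumes "\<And>x. x \<in> e \<Longrightarrow> p x = p' x" "\<And>x. x \<in> e \<Longrightarrow> m x = m' x"
  shows "edge_form p m e = edge_form p' m' e"
  using assms by (simp add: edge_form_def)

lemma edge_form_const_right:
  assumes "\<And>x. x \<in> e \<Longrightarrow> m x = a"
  shows "edge_form p m e = 0"
  using assms by (simp add: edge_form_def)

lemma edge_form_sum_left:
  assumes "finite I"
  shows "edge_form (\<lambda>x. \<Sum>i\<in>I. p i x) m e = (\<Sum>i\<in>I. edge_form (p i) m e)"
  using assms
proof induction
  case empty
  then show ?case by (simp add: edge_form_def)
next
  case (insert i I)
  then show ?case by (simp add: edge_form_add_left)
qed

section \<open>The rigidity matrix and equilibrium in weak form\<close>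

lemma graph_finite:
  assumes "looped_simple_graph G"
  shows "finite (verts G)" "finite (edges G)" "finite (loops G)"
proof -
  show "finite (verts G)" "finite (loops G)" using assms by (auto simp: looped_simple_graph_def)
  then have "finite (Pow (verts G))" by simp
  then show "finite (edges G)"
    by (rule rev_finite_subset) (use assms in \<open>auto simp: looped_simple_graph_def\<close>)
qed

lemma graph_edgeE:
  assumes "looped_simple_graph G" "e \<in> edges G"
  obtains x y where "e = {x, y}" "x \<noteq> y" "x \<in> verts G" "y \<in> verts G"
proof -
  have "card e = 2" "e \<subseteq> verts G" using assms by (auto simp: looped_simple_graph_def)
  then show ?thesis using that by (auto simp: card_2_iff)
qed

lemma graph_lvert:
  assumes "looped_simple_graph G" "l \<in> loops G"
  shows "lvert G l \<in> verts G"
  using assms by (auto simp: looped_simple_graph_def)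

definition vec_fun :: "('v \<times> 'd \<Rightarrow> real) \<Rightarrow> 'v \<Rightarrow> real ^ 'd" where
  "vec_fun f v = (\<chi> i. f (v, i))"

lemma vec_fun_fun [simp]: "vec_fun (\<lambda>(v, i). m v $ i) = m"
  by (simp add: vec_fun_def fun_eq_iff vec_eq_iff)

lemma rigidity_matrix_edge_row:
  assumes "looped_simple_graph G" "e \<in> edges G"
  shows "(\<Sum>c\<in>verts G \<times> UNIV. rigidity_matrix G p q (Inl e) c * f c) = edge_form p (vec_fun f) e"
proof -
  obtain x y where e: "e = {x, y}" "x \<noteq> y" "x \<in> verts G" "y \<in> verts G"
    using graph_edgeE[OF assms] by blast
  have "(\<Sum>c\<in>verts G \<times> UNIV. rigidity_matrix G p q (Inl e) c * f c)
      = (\<Sum>v\<in>verts G. \<Sum>i\<in>UNIV. rigidity_matrix G p q (Inl e) (v, i) * f (v, i))"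
    by (simp add: sum.cartesian_product case_prod_unfold del: rigidity_matrix.simps)
  also have "\<dots> = (\<Sum>v\<in>{x, y}. \<Sum>i\<in>UNIV. rigidity_matrix G p q (Inl e) (v, i) * f (v, i))"
    using graph_finite[OF assms(1)] e by (intro sum.mono_neutral_right) auto
  also have "\<dots> = (p x - p y) \<bullet> vec_fun f x + (p y - p x) \<bullet> vec_fun f y"
  proof -
    have "{x, y} - {x} = {y}" "{x, y} - {y} = {x}" using e(2) by auto
    then show ?thesis using e by (simp add: inner_vec_def vec_fun_def)
  qed
  also have "\<dots> = edge_form p (vec_fun f) e"
    by (simp add: e edge_form_doubleton inner_diff_left inner_diff_right)
  finally show ?thesis .
qed

lemma rigidity_matrix_loop_row:
  fixes p :: "'v \<Rightarrow> real ^ 'd"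
  assumes "looped_simple_graph G" "l \<in> loops G"
  shows "(\<Sum>c\<in>verts G \<times> UNIV. rigidity_matrix G p q (Inr l) c * f c)
    = q l \<bullet> vec_fun f (lvert G l)"
proof -
  have "(\<Sum>c\<in>verts G \<times> UNIV. rigidity_matrix G p q (Inr l) c * f c)
      = (\<Sum>v\<in>verts G. \<Sum>i\<in>UNIV. rigidity_matrix G p q (Inr l) (v, i) * f (v, i))"
    by (simp add: sum.cartesian_product case_prod_unfold del: rigidity_matrix.simps)
  also have "\<dots> = (\<Sum>v\<in>{lvert G l}. \<Sum>i\<in>UNIV. rigidity_matrix G p q (Inr l) (v, i) * f (v, i))"
    using graph_finite[OF assms(1)] graph_lvert[OF assms] by (intro sum.mono_neutral_right) auto
  also have "\<dots> = q l \<bullet> vec_fun f (lvert G l)"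
    by (simp add: inner_vec_def vec_fun_def)
  finally show ?thesis .
qed

text \<open>Here \<open>m\<close> runs over the infinitesimal motions of the framework.\<close>

definition rigid_kernel :: "('v, 'l) looped_graph \<Rightarrow> ('v \<Rightarrow> real ^ 'd) \<Rightarrow> ('l \<Rightarrow> real ^ 'd) \<Rightarrow> bool" where
  "rigid_kernel G p q \<longleftrightarrow> (\<forall>m. (\<forall>e\<in>edges G. edge_form p m e = 0) \<longrightarrow>
     (\<forall>l\<in>loops G. q l \<bullet> m (lvert G l) = 0) \<longrightarrow> (\<forall>v\<in>verts G. m v = 0))"

lemma rigid_kernelD:
  assumes "rigid_kernel G p q" "\<And>e. e \<in> edges G \<Longrightarrow> edge_form p m e = 0"
    "\<And>l. l \<in> loops G \<Longrightarrow> q l \<bullet> m (lvert G l) = 0" "v \<in> verts G"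
  shows "m v = 0"
  using assms by (auto simp: rigid_kernel_def)

lemma trivial_kernel_rigidity_matrix:
  fixes p :: "'v \<Rightarrow> real ^ 'd"
  assumes "looped_simple_graph G"
  shows "trivial_kernel (edges G <+> loops G) (verts G \<times> UNIV) (rigidity_matrix G p q)
    \<longleftrightarrow> rigid_kernel G p q"
proof
  assume t: "trivial_kernel (edges G <+> loops G) (verts G \<times> UNIV) (rigidity_matrix G p q)"
  show "rigid_kernel G p q"
    unfolding rigid_kernel_def
  proof (intro allI impI ballI)
    fix m v assume m: "\<forall>e\<in>edges G. edge_form p m e = 0"
      "\<forall>l\<in>loops G. q l \<bullet> m (lvert G l) = 0" and v: "v \<in> verts G"
    let ?f = "\<lambda>(v, i). m v $ i"
    have "?f (v, i) = 0" for i
    proof (rule trivial_kernelD[OF t])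
      fix r assume r: "r \<in> edges G <+> loops G"
      show "(\<Sum>c\<in>verts G \<times> UNIV. rigidity_matrix G p q r c * ?f c) = 0"
      proof (cases r)
        case (Inl e)
        then show ?thesis using rigidity_matrix_edge_row[OF assms, of e p q ?f] r m by auto
      next
        case (Inr l)
        then show ?thesis using rigidity_matrix_loop_row[OF assms, of l p q ?f] r m by auto
      qed
    qed (use v in auto)
    then show "m v = 0" by (simp add: vec_eq_iff)
  qed
next
  assume k: "rigid_kernel G p q"
  show "trivial_kernel (edges G <+> loops G) (verts G \<times> UNIV) (rigidity_matrix G p q)"
    unfolding trivial_kernel_def
  proof (intro allI impI ballI)
    fix f c assume f: "\<forall>r\<in>edges G <+> loops G. (\<Sum>c\<in>verts G \<times> UNIV. rigidity_matrix G p q r c * f c) = 0"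
      and c: "c \<in> verts G \<times> (UNIV :: 'd set)"
    have "vec_fun f (fst c) = 0"
    proof (rule rigid_kernelD[OF k])
      show "edge_form p (vec_fun f) e = 0" if "e \<in> edges G" for e
        using rigidity_matrix_edge_row[OF assms that, of p q f] f[rule_format, OF InlI[OF that]] by metis
      show "q l \<bullet> vec_fun f (lvert G l) = 0" if "l \<in> loops G" for l
        using rigidity_matrix_loop_row[OF assms that, of p q f] f[rule_format, OF InrI[OF that]] by metis
    qed (use c in auto)
    then show "f c = 0" by (cases c) (simp add: vec_fun_def vec_eq_iff)
  qed
qed

lemma infinitesimally_rigid_iff:
  assumes "looped_simple_graph G"
  shows "infinitesimally_rigid G p q \<longleftrightarrow> rigid_kernel G p q"
proof -
  have "infinitesimally_rigid G p q \<longleftrightarrow>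
     trivial_kernel (edges G <+> loops G) (verts G \<times> UNIV) (rigidity_matrix G p q)"
    using graph_finite[OF assms]
    by (simp add: infinitesimally_rigid_def mult.commute flip: matrix_rank_full_iff)
  then show ?thesis using trivial_kernel_rigidity_matrix[OF assms] by simp
qed

text \<open>This pairs a stress with the image of \<open>m\<close> under the rigidity matrix. It is
  linear in the stress, in the placement \<open>(p, q)\<close> and in the displacement
  \<open>m\<close>; the perturbation argument rests on this trilinearity.\<close>

definition virtual_work ::
  "('v, 'l) looped_graph \<Rightarrow> ('v set \<Rightarrow> real) \<Rightarrow> ('l \<Rightarrow> real) \<Rightarrow> ('v \<Rightarrow> real ^ 'd) \<Rightarrow>
   ('l \<Rightarrow> real ^ 'd) \<Rightarrow> ('v \<Rightarrow> real ^ 'd) \<Rightarrow> real" where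
  "virtual_work G \<omega> \<mu> p q m =
     (\<Sum>e\<in>edges G. \<omega> e * edge_form p m e) + (\<Sum>l\<in>loops G. \<mu> l * (q l \<bullet> m (lvert G l)))"

lemma sum_Plus_rows:
  assumes "looped_simple_graph G"
  shows "(\<Sum>r\<in>edges G <+> loops G. s r * f r) =
    (\<Sum>e\<in>edges G. s (Inl e) * f (Inl e)) + (\<Sum>l\<in>loops G. s (Inr l) * (f (Inr l) :: real))"
  using graph_finite[OF assms] by (subst sum.Plus) auto

lemma cokernel_pairing:
  fixes p :: "'v \<Rightarrow> real ^ 'd"
  assumes "looped_simple_graph G"
  shows "(\<Sum>c\<in>verts G \<times> UNIV. ((\<Sum>e \<in> edges G. \<omega> e * rigidity_matrix G p q (Inl e) c) +
       (\<Sum>l \<in> loops G. \<mu> l * rigidity_matrix G p q (Inr l) c)) * f c)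
    = virtual_work G \<omega> \<mu> p q (vec_fun f)"
proof -
  have "(\<Sum>c\<in>verts G \<times> UNIV. ((\<Sum>e \<in> edges G. \<omega> e * rigidity_matrix G p q (Inl e) c) +
       (\<Sum>l \<in> loops G. \<mu> l * rigidity_matrix G p q (Inr l) c)) * f c)
    = (\<Sum>c\<in>verts G \<times> UNIV. \<Sum>e\<in>edges G. \<omega> e * (rigidity_matrix G p q (Inl e) c * f c)) +
      (\<Sum>c\<in>verts G \<times> UNIV. \<Sum>l\<in>loops G. \<mu> l * (rigidity_matrix G p q (Inr l) c * f c))"
    by (simp add: distrib_right sum.distrib sum_distrib_right mult.assoc)
  also have "\<dots> = (\<Sum>e\<in>edges G. \<omega> e * (\<Sum>c\<in>verts G \<times> UNIV. rigidity_matrix G p q (Inl e) c * f c)) +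
      (\<Sum>l\<in>loops G. \<mu> l * (\<Sum>c\<in>verts G \<times> UNIV. rigidity_matrix G p q (Inr l) c * f c))"
    unfolding sum_distrib_left by (intro arg_cong2[where f = "(+)"] sum.swap)
  also have "\<dots> = virtual_work G \<omega> \<mu> p q (vec_fun f)"
    unfolding virtual_work_def
    by (intro arg_cong2[where f = "(+)"] sum.cong refl)
      (simp_all only: rigidity_matrix_edge_row[OF assms] rigidity_matrix_loop_row[OF assms])
  finally show ?thesis .
qed

lemma equilibrium_stress_iff:
  fixes p :: "'v \<Rightarrow> real ^ 'd"
  assumes "looped_simple_graph G"
  shows "equilibrium_stress G p q \<omega> \<mu> \<longleftrightarrow> (\<forall>m. virtual_work G \<omega> \<mu> p q m = 0)"
proof
  assume "equilibrium_stress G p q \<omega> \<mu>"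
  then have z: "\<forall>c \<in> verts G \<times> UNIV.
       (\<Sum>e \<in> edges G. \<omega> e * rigidity_matrix G p q (Inl e) c) +
       (\<Sum>l \<in> loops G. \<mu> l * rigidity_matrix G p q (Inr l) c) = 0"
    using equilibrium_stress_iff_cokernel[OF assms] by blast
  show "\<forall>m. virtual_work G \<omega> \<mu> p q m = 0"
  proof
    fix m
    have "virtual_work G \<omega> \<mu> p q (vec_fun (\<lambda>(v, i). m v $ i)) = 0"
      unfolding cokernel_pairing[OF assms, symmetric] by (intro sum.neutral ballI) (simp only: bspec[OF z] mult_zero_left)
    then show "virtual_work G \<omega> \<mu> p q m = 0" by (simp only: vec_fun_fun)
  qed
next
  assume z: "\<forall>m. virtual_work G \<omega> \<mu> p q m = 0"
  have "(\<Sum>e \<in> edges G. \<omega> e * rigidity_matrix G p q (Inl e) c) +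
       (\<Sum>l \<in> loops G. \<mu> l * rigidity_matrix G p q (Inr l) c) = 0"
    if "c \<in> verts G \<times> UNIV" for c
  proof -
    have "finite (verts G \<times> (UNIV :: 'd set))" using graph_finite[OF assms] by simp
    then show ?thesis
      using cokernel_pairing[OF assms, of \<omega> p q \<mu> "unit_fun c"] z that
      by (simp only: sum_unit_fun if_True)
  qed
  then show "equilibrium_stress G p q \<omega> \<mu>"
    using equilibrium_stress_iff_cokernel[OF assms] by blast
qed

section \<open>The stress matrix as a weighted Laplacian\<close>

lemma edge_form_unit_funs:
  assumes "card e = 2"
  shows "u \<noteq> v \<Longrightarrow> edge_form (unit_fun u) (unit_fun v) e = (if e = {u, v} then - 1 else 0)"
    "edge_form (unit_fun u) (unit_fun u) e = (if u \<in> e then 1 else 0)"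
proof -
  obtain x y where "e = {x, y}" "x \<noteq> y" using assms(1) by (auto simp: card_2_iff)
  then show "u \<noteq> v \<Longrightarrow> edge_form (unit_fun u) (unit_fun v) e = (if e = {u, v} then - 1 else 0)"
    "edge_form (unit_fun u) (unit_fun u) e = (if u \<in> e then 1 else 0)"
    by (auto simp: edge_form_doubleton unit_fun_def doubleton_eq_iff)
qed

text \<open>The values of \<open>edge_form\<close> on pairs of unit functions are the entries of the
  Laplacian of a single edge, and the stress matrix is the sum of these Laplacians weighted by
  \<open>\<omega>\<close>.\<close>

lemma stress_matrix_eq_edge_form:
  assumes "looped_simple_graph G"
  shows "stress_matrix G \<omega> u v = (\<Sum>e\<in>edges G. \<omega> e * edge_form (unit_fun u) (unit_fun v) e)"
proof (cases "u = v")
  case True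
  have two: "card e = 2" if "e \<in> edges G" for e
    using assms that by (auto simp: looped_simple_graph_def)
  have "edge_form (unit_fun v) (unit_fun v) e = (if v \<in> e then 1 else 0)" if "e \<in> edges G" for e
    using edge_form_unit_funs(2) two[OF that] .
  then have "(\<Sum>e\<in>edges G. \<omega> e * edge_form (unit_fun v) (unit_fun v) e)
      = (\<Sum>e\<in>edges G. if v \<in> e then \<omega> e else 0)"
    by (intro sum.cong) auto
  also have "\<dots> = (\<Sum>e | e \<in> edges G \<and> v \<in> e. \<omega> e)"
    using graph_finite[OF assms] by (intro sum.inter_filter[symmetric]) auto
  finally show ?thesis using True by (simp add: stress_matrix_def)
next
  case False
  then have "(\<Sum>e\<in>edges G. \<omega> e * edge_form (unit_fun u) (unit_fun v) e)
      = (\<Sum>e\<in>edges G. if e = {u, v} then - \<omega> e else 0)"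
    using assms by (intro sum.cong) (auto simp: looped_simple_graph_def edge_form_unit_funs)
  then show ?thesis
    using False graph_finite[OF assms] by (simp add: stress_matrix_def)
qed

lemma supported_edge_form_left:
  assumes "finite V" "e \<subseteq> V"
  shows "edge_form f g e = (\<Sum>c\<in>V. f c * edge_form (unit_fun c) g e)"
proof -
  have "edge_form f g e = edge_form (\<lambda>x. \<Sum>c\<in>V. f c *\<^sub>R unit_fun c x) g e"
    using assms by (intro edge_form_cong) (auto simp: sum_unit_fun)
  also have "\<dots> = (\<Sum>c\<in>V. edge_form (\<lambda>x. f c *\<^sub>R unit_fun c x) g e)"
    by (rule edge_form_sum_left[OF assms(1)])
  finally show ?thesis by (simp add: edge_form_scale_left del: real_scaleR_def)
qed

definition stress_form ::
  "('v, 'l) looped_graph \<Rightarrow> ('v set \<Rightarrow> real) \<Rightarrow> ('v \<Rightarrow> real) \<Rightarrow> ('v \<Rightarrow> real) \<Rightarrow> real" where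
  "stress_form G \<omega> f g = (\<Sum>e\<in>edges G. \<omega> e * edge_form f g e)"

lemma stress_matrix_row:
  assumes "looped_simple_graph G"
  shows "(\<Sum>c\<in>verts G. stress_matrix G \<omega> v c * f c) = stress_form G \<omega> f (unit_fun v)"
proof -
  have "(\<Sum>c\<in>verts G. stress_matrix G \<omega> v c * f c)
      = (\<Sum>c\<in>verts G. \<Sum>e\<in>edges G. \<omega> e * (f c * edge_form (unit_fun c) (unit_fun v) e))"
    using edge_form_commute[of "unit_fun v"]
    by (simp add: stress_matrix_eq_edge_form[OF assms] sum_distrib_right sum_distrib_left mult.assoc mult.commute mult.left_commute)
  also have "\<dots> = (\<Sum>e\<in>edges G. \<omega> e * (\<Sum>c\<in>verts G. f c * edge_form (unit_fun c) (unit_fun v) e))"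
    unfolding sum_distrib_left by (rule sum.swap)
  also have "\<dots> = stress_form G \<omega> f (unit_fun v)"
    unfolding stress_form_def
    using assms graph_finite[OF assms]
    by (intro sum.cong refl) (auto simp: looped_simple_graph_def intro!: supported_edge_form_left[symmetric])
  finally show ?thesis .
qed

lemma stress_form_eq_sum:
  assumes "looped_simple_graph G"
  shows "stress_form G \<omega> f g = (\<Sum>v\<in>verts G. g v * stress_form G \<omega> f (unit_fun v))"
proof -
  have "stress_form G \<omega> f g = (\<Sum>e\<in>edges G. \<omega> e * (\<Sum>c\<in>verts G. g c * edge_form f (unit_fun c) e))"
    unfolding stress_form_def edge_form_commute[of f]
    using assms graph_finite[OF assms]
    by (intro sum.cong refl) (auto simp: looped_simple_graph_def intro!: supported_edge_form_left)
  also have "\<dots> = (\<Sum>v\<in>verts G. \<Sum>e\<in>edges G. g v * (\<omega> e * edge_form f (unit_fun v) e))"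
    unfolding sum_distrib_left by (subst sum.swap) (simp add: mult.left_commute)
  finally show ?thesis by (simp add: stress_form_def sum_distrib_left)
qed

text \<open>Constants always lie in the radical of the stress form; here nothing else does, up to
  values outside the vertex set. This is corank one for a nonempty vertex set. It holds vacuously
  without vertices, where \<open>full_rank_stress\<close> fails.\<close>

definition stress_kernel_const :: "('v, 'l) looped_graph \<Rightarrow> ('v set \<Rightarrow> real) \<Rightarrow> bool" where
  "stress_kernel_const G \<omega> \<longleftrightarrow> (\<forall>f. (\<forall>g. stress_form G \<omega> f g = 0) \<longrightarrow>
     (\<forall>u\<in>verts G. \<forall>v\<in>verts G. f u = f v))"

text \<open>This turns the rank condition into a trivial kernel, the form to which the perturbation
  lemma applies. Any vertex can serve as \<open>v0\<close>, because the rows of the stress matrix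
  have sum zero.\<close>

lemma full_rank_stress_augmented_iff:
  assumes "looped_simple_graph G" "v0 \<in> verts G"
  shows "full_rank_stress G \<omega> \<longleftrightarrow> trivial_kernel (insert None (Some ` verts G)) (verts G)
    (case_option (unit_fun v0) (stress_matrix G \<omega>))"
proof -
  have "(\<Sum>c\<in>verts G. stress_matrix G \<omega> r c) = 0" for r
    using stress_matrix_row[OF assms(1), of \<omega> r "\<lambda>_. 1"]
    by (simp add: stress_form_def edge_form_def)
  then show ?thesis unfolding full_rank_stress_def
    using graph_finite[OF assms(1)] assms(2) by (intro matrix_rank_corank_one_iff) auto
qed

text \<open>The unit row normalises \<open>f\<close> to vanish at \<open>v0\<close>. Subtracting the
  constant \<open>f v0\<close> achieves this and is invisible to \<open>edge_form\<close>.\<close>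

lemma full_rank_stress_iff:
  assumes "looped_simple_graph G"
  shows "full_rank_stress G \<omega> \<longleftrightarrow> verts G \<noteq> {} \<and> stress_kernel_const G \<omega>"
proof (cases "verts G = {}")
  case True
  then show ?thesis by (simp add: full_rank_stress_def)
next
  case False
  then obtain v0 where v0: "v0 \<in> verts G" by blast
  have V: "finite (verts G)" using graph_finite[OF assms] by blast
  have "trivial_kernel (insert None (Some ` verts G)) (verts G)
      (case_option (unit_fun v0) (stress_matrix G \<omega>)) \<longleftrightarrow>
    (\<forall>f. f v0 = 0 \<and> (\<forall>v\<in>verts G. stress_form G \<omega> f (unit_fun v) = 0) \<longrightarrow> (\<forall>v\<in>verts G. f v = 0))"
    using v0 V by (simp add: trivial_kernel_def stress_matrix_row[OF assms] sum_unit_fun)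
  also have "\<dots> \<longleftrightarrow> (\<forall>f. f v0 = 0 \<and> (\<forall>g. stress_form G \<omega> f g = 0) \<longrightarrow> (\<forall>v\<in>verts G. f v = 0))"
  proof -
    have "(\<forall>v\<in>verts G. stress_form G \<omega> f (unit_fun v) = 0) \<longleftrightarrow> (\<forall>g. stress_form G \<omega> f g = 0)" for f
      by (auto intro: trans[OF stress_form_eq_sum[OF assms]])
    then show ?thesis by simp
  qed
  also have "\<dots> \<longleftrightarrow> stress_kernel_const G \<omega>"
  proof
    assume L: "\<forall>f. f v0 = 0 \<and> (\<forall>g. stress_form G \<omega> f g = 0) \<longrightarrow> (\<forall>v\<in>verts G. f v = 0)"
    show "stress_kernel_const G \<omega>"
      unfolding stress_kernel_const_def
    proof (intro allI impI ballI)
      fix f u v assume f: "\<forall>g. stress_form G \<omega> f g = 0" and uv: "u \<in> verts G" "v \<in> verts G"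
      have "stress_form G \<omega> (\<lambda>x. f x - f v0) g = 0" for g
      proof -
        have "edge_form (\<lambda>x. f x - f v0) g e = edge_form f g e" for e
          by (simp add: edge_form_def)
        then show ?thesis using f by (simp add: stress_form_def)
      qed
      then have "\<forall>x\<in>verts G. f x - f v0 = 0"
        using L[rule_format, of "\<lambda>x. f x - f v0"] by auto
      then show "f u = f v" using uv by auto
    qed
  next
    assume "stress_kernel_const G \<omega>"
    then show "\<forall>f. f v0 = 0 \<and> (\<forall>g. stress_form G \<omega> f g = 0) \<longrightarrow> (\<forall>v\<in>verts G. f v = 0)"
      using v0 unfolding stress_kernel_const_def by metis
  qed
  finally show ?thesis using full_rank_stress_augmented_iff[OF assms v0] False by simp
qed

section \<open>Perturbing a realisation together with its stress\<close>

text \<open>For a left inverse \<open>L\<close>, every row of \<open>I - M L\<close> lies in the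
  cokernel of \<open>M\<close>. By hypothesis these rows vanish at \<open>i\<close>, which says that
  \<open>M\<close> maps column \<open>i\<close> of \<open>L\<close> to the unit vector at
  \<open>i\<close>.\<close>

lemma cokernel_zero_imp_preimage:
  fixes M :: "'r \<Rightarrow> 'c \<Rightarrow> real"
  assumes "finite R" "finite C" "trivial_kernel R C M" "i \<in> R"
    and zero: "\<And>s. (\<And>c. c \<in> C \<Longrightarrow> (\<Sum>r\<in>R. s r * M r c) = 0) \<Longrightarrow> s i = 0"
  shows "\<exists>m. \<forall>r\<in>R. (\<Sum>c\<in>C. M r c * m c) = unit_fun i r"
proof -
  obtain L where L: "\<And>c d. c \<in> C \<Longrightarrow> d \<in> C \<Longrightarrow> (\<Sum>r\<in>R. L c r * M r d) = unit_fun c d"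
    using left_inverse_exists[OF assms(1-3)] by blast
  have "(\<Sum>c\<in>C. M k c * L c i) = unit_fun i k" if k: "k \<in> R" for k
  proof -
    define s where "s r = unit_fun k r - (\<Sum>c\<in>C. M k c * L c r)" for r
    have "(\<Sum>r\<in>R. s r * M r d) = 0" if d: "d \<in> C" for d
    proof -
      have "(\<Sum>r\<in>R. s r * M r d) = M k d - (\<Sum>r\<in>R. (\<Sum>c\<in>C. M k c * L c r) * M r d)"
        using k assms(1) by (simp add: s_def left_diff_distrib sum_subtractf sum_unit_fun)
      also have "(\<Sum>r\<in>R. (\<Sum>c\<in>C. M k c * L c r) * M r d) = (\<Sum>c\<in>C. M k c * (\<Sum>r\<in>R. L c r * M r d))"
        unfolding sum_distrib_left sum_distrib_right mult.assoc by (rule sum.swap)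
      also have "\<dots> = (\<Sum>c\<in>C. M k c * unit_fun c d)" using L d by (intro sum.cong) auto
      finally show ?thesis using d assms(2) by (simp add: sum_unit_fun)
    qed
    then have "s i = 0" by (rule zero)
    then have "(\<Sum>c\<in>C. M k c * L c i) = unit_fun k i" by (simp add: s_def)
    also have "\<dots> = unit_fun i k" by (auto simp: unit_fun_def)
    finally show ?thesis .
  qed
  then show ?thesis by (intro exI[of _ "\<lambda>c. L c i"]) blast
qed

text \<open>Each entry of the stress matrix is a sum over the edges of weights with coefficients of
  absolute value at most 1. A small change of weights is thus a small change of the augmented
  matrix, whose kernel stays trivial.\<close>

lemma stress_kernel_const_perturb:
  fixes G :: "('v, 'l) looped_graph"
  assumes G: "looped_simple_graph G" and k: "stress_kernel_const G \<omega>"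
  obtains \<epsilon> where "\<epsilon> > 0"
    "\<And>\<omega>'. (\<And>e. e \<in> edges G \<Longrightarrow> \<bar>\<omega>' e - \<omega> e\<bar> \<le> \<epsilon>) \<Longrightarrow> stress_kernel_const G \<omega>'"
proof (cases "verts G = {}")
  case True
  then show ?thesis using that[of 1] by (simp add: stress_kernel_const_def)
next
  case False
  then obtain v0 where v0: "v0 \<in> verts G" by blast
  let ?M = "\<lambda>\<omega>. case_option (unit_fun v0) (stress_matrix G \<omega>)"
  let ?R = "insert None (Some ` verts G)"
  have iff: "stress_kernel_const G \<omega> \<longleftrightarrow> trivial_kernel ?R (verts G) (?M \<omega>)" for \<omega>
    using full_rank_stress_iff[OF G] full_rank_stress_augmented_iff[OF G v0] False by blast
  have fin: "finite ?R" "finite (verts G)" using graph_finite[OF G] by auto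
  obtain \<delta> K where \<delta>: "\<delta> > 0" and "K > 0"
    and tk: "\<And>M'. (\<forall>r\<in>?R. \<forall>c\<in>verts G. \<bar>M' r c - ?M \<omega> r c\<bar> \<le> \<delta>) \<Longrightarrow>
       trivial_kernel ?R (verts G) M' \<and>
       (\<forall>g. \<exists>s. (\<forall>c\<in>verts G. (\<Sum>r\<in>?R. s r * M' r c) = g c) \<and>
                (\<forall>r\<in>?R. \<bar>s r\<bar> \<le> K * (\<Sum>c\<in>verts G. \<bar>g c\<bar>)))"
    using trivial_kernel_perturb[OF fin iff[THEN iffD1, OF k]] by blast
  define \<epsilon> where "\<epsilon> = \<delta> / (real (card (edges G)) + 1)"
  have \<epsilon>: "\<epsilon> > 0" using \<delta> by (simp add: \<epsilon>_def add_nonneg_pos)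
  have "card (edges G) * (\<epsilon> * 1) \<le> (real (card (edges G)) + 1) * \<epsilon>"
    using \<epsilon> by (simp add: distrib_right)
  also have "\<dots> = \<delta>" by (simp add: \<epsilon>_def add_nonneg_eq_0_iff)
  finally have e\<delta>: "card (edges G) * (\<epsilon> * 1) \<le> \<delta>" .
  show ?thesis
  proof (rule that[OF \<epsilon>])
    fix \<omega>' assume w: "\<And>e. e \<in> edges G \<Longrightarrow> \<bar>\<omega>' e - \<omega> e\<bar> \<le> \<epsilon>"
    have "\<bar>stress_matrix G \<omega>' u v - stress_matrix G \<omega> u v\<bar> \<le> \<delta>" for u v
    proof -
      have "stress_matrix G \<omega>' u v - stress_matrix G \<omega> u v
          = (\<Sum>e\<in>edges G. (\<omega>' e - \<omega> e) * edge_form (unit_fun u) (unit_fun v) e)"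
        by (simp add: stress_matrix_eq_edge_form[OF G] left_diff_distrib sum_subtractf)
      also have "\<bar>\<dots>\<bar> \<le> card (edges G) * (\<epsilon> * 1)"
      proof (rule abs_sum_mult_le)
        fix e assume "e \<in> edges G"
        then have "card e = 2" using G by (auto simp: looped_simple_graph_def)
        then show "\<bar>edge_form (unit_fun u) (unit_fun v) e\<bar> \<le> 1"
          using edge_form_unit_funs(1)[of e u v] edge_form_unit_funs(2)[of e u]
          by (cases "u = v") auto
      qed (use w in auto)
      finally show ?thesis using e\<delta> by simp
    qed
    then have "trivial_kernel ?R (verts G) (?M \<omega>')"
      using tk[of "?M \<omega>'"] \<delta> by (auto split: option.split)
    then show "stress_kernel_const G \<omega>'" using iff by blast
  qed
qed

lemma virtual_work_add_placement:
  "virtual_work G \<omega> \<mu> (\<lambda>x. p x + t *\<^sub>R w x) (\<lambda>l. q l + t *\<^sub>R r l) m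
    = virtual_work G \<omega> \<mu> p q m + t * virtual_work G \<omega> \<mu> w r m"
  by (simp add: virtual_work_def edge_form_add_left edge_form_scale_left inner_add_left
      distrib_left sum.distrib sum_distrib_left mult.left_commute)

lemma virtual_work_add_stress:
  "virtual_work G (\<lambda>e. \<omega> e + t * \<omega>' e) (\<lambda>l. \<mu> l + t * \<mu>' l) p q m
    = virtual_work G \<omega> \<mu> p q m + t * virtual_work G \<omega>' \<mu>' p q m"
  by (simp add: virtual_work_def distrib_right distrib_left sum.distrib sum_distrib_left mult.assoc)

lemma virtual_work_eq_0_iff_cokernel:
  fixes p :: "'v \<Rightarrow> real ^ 'd"
  assumes "looped_simple_graph G"
  shows "(\<forall>m. virtual_work G (s \<circ> Inl) (s \<circ> Inr) p q m = 0) \<longleftrightarrow>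
    (\<forall>c\<in>verts G \<times> UNIV. (\<Sum>r\<in>edges G <+> loops G. s r * rigidity_matrix G p q r c) = 0)"
  using equilibrium_stress_iff[OF assms, of p q "s \<circ> Inl" "s \<circ> Inr"]
    equilibrium_stress_iff_cokernel[OF assms, of p q "s \<circ> Inl" "s \<circ> Inr"]
  by (simp only: sum_Plus_rows[OF assms] o_def)

text \<open>The stress is one function on the row indices of the rigidity matrix, so that a deleted
  edge and a deleted loop are both just an index \<open>i\<close>.\<close>

definition good_realisation ::
  "('v, 'l) looped_graph \<Rightarrow> ('v \<Rightarrow> real ^ 'd) \<Rightarrow> ('l \<Rightarrow> real ^ 'd) \<Rightarrow> ('v set + 'l \<Rightarrow> real) \<Rightarrow> bool" where
  "good_realisation G p q s \<longleftrightarrow> rigid_kernel G p q \<and>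
     (\<forall>m. virtual_work G (s \<circ> Inl) (s \<circ> Inr) p q m = 0) \<and> stress_kernel_const G (s \<circ> Inl)"

text \<open>The factor 2 arises because an edge entry is a difference of two positions, both of
  which may move.\<close>

lemma rigidity_matrix_close:
  fixes p :: "'v \<Rightarrow> real ^ 'd"
  assumes G: "looped_simple_graph G"
    and p: "\<And>v. v \<in> verts G \<Longrightarrow> norm (p' v - p v) \<le> \<delta>"
    and q: "\<And>l. l \<in> loops G \<Longrightarrow> norm (q' l - q l) \<le> \<delta>"
    and r: "r \<in> edges G <+> loops G" and \<delta>: "\<delta> \<ge> 0"
  shows "\<bar>rigidity_matrix G p' q' r c - rigidity_matrix G p q r c\<bar> \<le> 2 * \<delta>"
proof (cases r)
  case (Inl e)
  then have "e \<in> edges G" using r by auto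
  then obtain x y where e: "e = {x, y}" "x \<noteq> y" "x \<in> verts G" "y \<in> verts G"
    using graph_edgeE[OF G] by metis
  obtain v i where c: "c = (v, i)" by (cases c)
  have *: "\<bar>(p' a - p' b) $ i - (p a - p b) $ i\<bar> \<le> 2 * \<delta>" if "a \<in> verts G" "b \<in> verts G" for a b
  proof -
    have "\<bar>(p' a - p' b) $ i - (p a - p b) $ i\<bar> = \<bar>((p' a - p a) - (p' b - p b)) $ i\<bar>" by simp
    also have "\<dots> \<le> norm ((p' a - p a) - (p' b - p b))" by (rule component_le_norm_cart)
    also have "\<dots> \<le> norm (p' a - p a) + norm (p' b - p b)" by (rule norm_triangle_ineq4)
    finally show ?thesis using p[OF that(1)] p[OF that(2)] by linarith
  qed
  have "e - {x} = {y}" "e - {y} = {x}" using e by auto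
  then show ?thesis using e *[of x y] *[of y x] \<delta> by (auto simp: Inl c)
next
  case (Inr l)
  then have l: "l \<in> loops G" using r by auto
  obtain v i where c: "c = (v, i)" by (cases c)
  have "\<bar>(q' l - q l) $ i\<bar> \<le> \<delta>" using q[OF l] component_le_norm_cart order_trans by blast
  then show ?thesis using \<delta> by (auto simp: Inr c)
qed

text \<open>\<open>cokernel_perturb\<close> preserves rigidity and continues the stress. The
  continued stress is close to the old one, which preserves the constant kernel.\<close>

lemma good_realisation_perturb:
  fixes p :: "'v \<Rightarrow> real ^ 'd" and G :: "('v, 'l) looped_graph"
  assumes G: "looped_simple_graph G" and good: "good_realisation G p q s" and "\<epsilon> > 0"
  obtains \<delta> where "\<delta> > 0"
    "\<And>p' q'. (\<And>v. v \<in> verts G \<Longrightarrow> norm (p' v - p v) \<le> \<delta>) \<Longrightarrow>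
       (\<And>l. l \<in> loops G \<Longrightarrow> norm (q' l - q l) \<le> \<delta>) \<Longrightarrow>
       \<exists>s'. good_realisation G p' q' s' \<and> (\<forall>r\<in>edges G <+> loops G. \<bar>s' r - s r\<bar> \<le> \<epsilon>)"
proof -
  let ?R = "edges G <+> loops G" and ?C = "verts G \<times> (UNIV :: 'd set)"
  obtain \<epsilon>0 where \<epsilon>0: "\<epsilon>0 > 0"
    "\<And>\<omega>'. (\<And>e. e \<in> edges G \<Longrightarrow> \<bar>\<omega>' e - (s \<circ> Inl) e\<bar> \<le> \<epsilon>0) \<Longrightarrow> stress_kernel_const G \<omega>'"
    using stress_kernel_const_perturb[OF G, of "s \<circ> Inl"] good
    unfolding good_realisation_def by blast
  have fin: "finite ?R" "finite ?C" using graph_finite[OF G] by auto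
  have tk: "trivial_kernel ?R ?C (rigidity_matrix G p q)"
    using good trivial_kernel_rigidity_matrix[OF G] by (auto simp: good_realisation_def)
  have ck: "(\<Sum>r\<in>?R. s r * rigidity_matrix G p q r c) = 0" if "c \<in> ?C" for c
    using good virtual_work_eq_0_iff_cokernel[OF G, of s p q] that by (auto simp: good_realisation_def)
  \<comment> \<open>\<open>\<epsilon>\<close> is the requested accuracy, \<open>\<epsilon>0\<close>
    the one that keeps the stress of full rank.\<close>
  have min: "min \<epsilon> \<epsilon>0 > 0" using \<open>\<epsilon> > 0\<close> \<epsilon>0 by simp
  obtain \<delta> where \<delta>: "\<delta> > 0" and pert:
    "\<And>M'. (\<forall>r\<in>?R. \<forall>c\<in>?C. \<bar>M' r c - rigidity_matrix G p q r c\<bar> \<le> \<delta>) \<Longrightarrow>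
       trivial_kernel ?R ?C M' \<and>
       (\<exists>s'. (\<forall>c\<in>?C. (\<Sum>r\<in>?R. s' r * M' r c) = 0) \<and> (\<forall>r\<in>?R. \<bar>s' r - s r\<bar> \<le> min \<epsilon> \<epsilon>0))"
    using cokernel_perturb[OF fin tk ck min] by blast
  show ?thesis
  proof (rule that[of "\<delta> / 2"])
    show "0 < \<delta> / 2" using \<delta> by simp
    fix p' q'
    assume "\<And>v. v \<in> verts G \<Longrightarrow> norm (p' v - p v) \<le> \<delta> / 2"
      "\<And>l. l \<in> loops G \<Longrightarrow> norm (q' l - q l) \<le> \<delta> / 2"
    then have "\<bar>rigidity_matrix G p' q' r c - rigidity_matrix G p q r c\<bar> \<le> \<delta>" if "r \<in> ?R" for r c
      using rigidity_matrix_close[OF G, of p' p "\<delta> / 2" q' q r c] \<delta> that by simp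
    then obtain s' where tk': "trivial_kernel ?R ?C (rigidity_matrix G p' q')"
      and s': "\<forall>c\<in>?C. (\<Sum>r\<in>?R. s' r * rigidity_matrix G p' q' r c) = 0"
        "\<forall>r\<in>?R. \<bar>s' r - s r\<bar> \<le> min \<epsilon> \<epsilon>0"
      using pert[of "rigidity_matrix G p' q'"] by blast
    have "\<bar>(s' \<circ> Inl) e - (s \<circ> Inl) e\<bar> \<le> \<epsilon>0" if "e \<in> edges G" for e
      using s'(2)[rule_format, OF InlI[OF that]] by simp
    then have "stress_kernel_const G (s' \<circ> Inl)" by (rule \<epsilon>0(2))
    then have "good_realisation G p' q' s'"
      unfolding good_realisation_def
      using trivial_kernel_rigidity_matrix[OF G, THEN iffD1, OF tk']
        virtual_work_eq_0_iff_cokernel[OF G, THEN iffD2, OF s'(1)] by blast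
    then show "\<exists>s'. good_realisation G p' q' s' \<and> (\<forall>r\<in>?R. \<bar>s' r - s r\<bar> \<le> \<epsilon>)"
      using s'(2) by auto
  qed
qed

lemma virtual_work_unit:
  assumes G: "looped_simple_graph G" and i: "i \<in> edges G <+> loops G"
    and m: "\<And>e. e \<in> edges G \<Longrightarrow> edge_form p m e = unit_fun i (Inl e)"
      "\<And>l. l \<in> loops G \<Longrightarrow> q l \<bullet> m (lvert G l) = unit_fun i (Inr l)"
  shows "virtual_work G (s \<circ> Inl) (s \<circ> Inr) p q m = s i"
proof -
  have "virtual_work G (s \<circ> Inl) (s \<circ> Inr) p q m = (\<Sum>r\<in>edges G <+> loops G. s r * unit_fun i r)"
    using m by (simp add: virtual_work_def sum_Plus_rows[OF G])
  then show ?thesis using i graph_finite[OF G] by (simp add: sum_unit_fun)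
qed

text \<open>Work of a stress against \<open>m\<close> at \<open>(p, q)\<close> is its value at
  \<open>i\<close>. Equilibrium at the placement moved by \<open>t\<close> in the direction
  \<open>(w, r)\<close> therefore reads \<open>0 = s' i + t * ?D s'\<close>, and
  \<open>?D s'\<close> is nonzero because \<open>s'\<close> is close to \<open>s\<close>.\<close>

lemma good_realisation_nonzero_step:
  fixes p :: "'v \<Rightarrow> real ^ 'd" and G :: "('v, 'l) looped_graph"
  assumes G: "looped_simple_graph G" and good: "good_realisation G p q s"
    and i: "i \<in> edges G <+> loops G"
    and m: "\<And>e. e \<in> edges G \<Longrightarrow> edge_form p m e = unit_fun i (Inl e)"
      "\<And>l. l \<in> loops G \<Longrightarrow> q l \<bullet> m (lvert G l) = unit_fun i (Inr l)"
    and D: "virtual_work G (s \<circ> Inl) (s \<circ> Inr) w r m \<noteq> 0"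
  shows "\<exists>p' q' s'. good_realisation G p' (q' :: 'l \<Rightarrow> real ^ 'd) s' \<and> s' i \<noteq> 0"
proof -
  let ?R = "edges G <+> loops G"
  let ?D = "\<lambda>s. virtual_work G (s \<circ> Inl) (s \<circ> Inr) w r m"
  \<comment> \<open>The coefficients of \<open>?D\<close> as a linear functional of the
    stress.\<close>
  define h where "h = case_sum (edge_form w m) (\<lambda>l. r l \<bullet> m (lvert G l))"
  have Dh: "?D s = (\<Sum>r\<in>?R. s r * h r)" for s
    by (simp add: virtual_work_def sum_Plus_rows[OF G] h_def)
  have fin: "finite ?R" using graph_finite[OF G] by auto
  obtain K where K: "K > 0" "\<And>r. r \<in> ?R \<Longrightarrow> \<bar>h r\<bar> \<le> K"
    using finite_abs_bound[OF fin, of h] by metis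
  define N where "N = (real (card ?R) + 1) * K"
  \<comment> \<open>Chosen so that a stress within \<open>\<epsilon>\<close> of \<open>s\<close>
    changes \<open>?D\<close> by at most half of \<open>\<bar>?D s\<bar>\<close>.\<close>
  define \<epsilon> where "\<epsilon> = \<bar>?D s\<bar> / (2 * N)"
  have N: "N > 0" using K unfolding N_def by (intro mult_pos_pos) auto
  have \<epsilon>: "\<epsilon> > 0" using D N by (simp add: \<epsilon>_def)
  have "card ?R * (\<epsilon> * K) \<le> N * \<epsilon>"
    using K \<epsilon> by (simp add: N_def algebra_simps)
  also have "\<dots> = \<bar>?D s\<bar> / 2" using N by (simp add: \<epsilon>_def)
  also have "\<dots> < \<bar>?D s\<bar>" using D by simp
  finally have eps: "card ?R * (\<epsilon> * K) < \<bar>?D s\<bar>" .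
  obtain \<delta> where \<delta>: "\<delta> > 0" and pert:
    "\<And>p' q'. (\<And>v. v \<in> verts G \<Longrightarrow> norm (p' v - p v) \<le> \<delta>) \<Longrightarrow>
       (\<And>l. l \<in> loops G \<Longrightarrow> norm (q' l - q l) \<le> \<delta>) \<Longrightarrow>
       \<exists>s'. good_realisation G p' q' s' \<and> (\<forall>r\<in>?R. \<bar>s' r - s r\<bar> \<le> \<epsilon>)"
    using good_realisation_perturb[OF G good \<epsilon>] by metis
  obtain A where A: "A > 0" "\<And>v. v \<in> verts G \<Longrightarrow> \<bar>norm (w v)\<bar> \<le> A"
    using finite_abs_bound[of "verts G" "\<lambda>v. norm (w v)"] graph_finite[OF G] by metis
  obtain B where B: "B > 0" "\<And>l. l \<in> loops G \<Longrightarrow> \<bar>norm (r l)\<bar> \<le> B"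
    using finite_abs_bound[of "loops G" "\<lambda>v. norm (r v)"] graph_finite[OF G] by metis
  \<comment> \<open>A positive step for which both \<open>t w\<close> and \<open>t r\<close> stay
    within \<open>\<delta>\<close>.\<close>
  define t where "t = \<delta> / (A + B)"
  have t: "t > 0" using A B \<delta> by (simp add: t_def)
  have small: "t * x \<le> \<delta>" if "x \<le> A + B" for x
  proof -
    have "t * x \<le> t * (A + B)" using that t by (intro mult_left_mono) auto
    also have "\<dots> = \<delta>" using A B by (simp add: t_def)
    finally show ?thesis .
  qed
  let ?p = "\<lambda>x. p x + t *\<^sub>R w x" and ?q = "\<lambda>l. q l + t *\<^sub>R r l"
  have "norm (?p v - p v) \<le> \<delta>" if "v \<in> verts G" for v
    using small[of "norm (w v)"] A(2)[OF that] B t by simp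
  moreover have "norm (?q l - q l) \<le> \<delta>" if "l \<in> loops G" for l
    using small[of "norm (r l)"] B(2)[OF that] A t by simp
  ultimately obtain s' where s': "good_realisation G ?p ?q s'" "\<forall>r\<in>?R. \<bar>s' r - s r\<bar> \<le> \<epsilon>"
    using pert[of ?p ?q] by blast
  have "\<bar>?D s' - ?D s\<bar> = \<bar>\<Sum>r\<in>?R. (s' r - s r) * h r\<bar>"
    by (simp add: Dh left_diff_distrib sum_subtractf)
  also have "\<dots> \<le> card ?R * (\<epsilon> * K)"
    using s'(2) K by (intro abs_sum_mult_le) auto
  finally have "?D s' \<noteq> 0" using eps by auto
  moreover have "virtual_work G (s' \<circ> Inl) (s' \<circ> Inr) ?p ?q m = 0"
    using s'(1) unfolding good_realisation_def by blast
  then have "0 = s' i + t * ?D s'"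
    by (simp add: virtual_work_add_placement virtual_work_unit[OF G i m])
  ultimately have "s' i \<noteq> 0" using t by auto
  then show ?thesis using s'(1) by blast
qed

section \<open>Stresses that do not vanish on a given edge or loop\<close>

lemma edge_form_axis:
  fixes m :: "'v \<Rightarrow> real ^ 'd"
  shows "edge_form (\<lambda>x. g x *\<^sub>R axis j 1) m e = edge_form (\<lambda>x. m x $ j) g e"
proof -
  have "(g x *\<^sub>R axis j 1 - g y *\<^sub>R axis j 1) \<bullet> (m x - m y) = (m x $ j - m y $ j) * (g x - g y)" for x y
    by (simp add: inner_axis' inner_diff_right algebra_simps flip: scaleR_diff_left)
  then show ?thesis by (simp add: edge_form_def)
qed

text \<open>Testing with a real function times the coordinate vector \<open>axis j 1\<close> puts
  the \<open>j\<close>-th coordinate of \<open>m\<close> into the radical of the stress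
  form.\<close>

lemma stress_kernel_const_vec:
  fixes m :: "'v \<Rightarrow> real ^ 'd"
  assumes "stress_kernel_const G \<omega>" "\<And>w :: 'v \<Rightarrow> real ^ 'd. (\<Sum>e\<in>edges G. \<omega> e * edge_form w m e) = 0"
    and "u \<in> verts G" "v \<in> verts G"
  shows "m u = m v"
proof -
  have "m u $ j = m v $ j" for j
  proof -
    have "stress_form G \<omega> (\<lambda>x. m x $ j) g = 0" for g
      using assms(2)[of "\<lambda>x. g x *\<^sub>R axis j 1"] by (simp add: stress_form_def edge_form_axis)
    then show ?thesis
      using assms(1,3,4) unfolding stress_kernel_const_def by metis
  qed
  then show ?thesis by (simp add: vec_eq_iff)
qed

text \<open>Vectors with no common nonzero orthogonal vector span; if they were also independent as
  a family, they would form a basis and their number would be the dimension.\<close>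

lemma spanning_loops_dependent:
  fixes q :: "'l \<Rightarrow> real ^ 'd"
  assumes "finite L" "card L \<noteq> CARD('d)"
    and span: "\<And>x. (\<And>l. l \<in> L \<Longrightarrow> q l \<bullet> x = 0) \<Longrightarrow> x = 0"
  shows "\<exists>\<mu>. (\<exists>l\<in>L. \<mu> l \<noteq> 0) \<and> (\<Sum>l\<in>L. \<mu> l *\<^sub>R q l) = 0"
proof (rule ccontr)
  assume "\<not> ?thesis"
  then have triv: "\<mu> l = 0" if "l \<in> L" "(\<Sum>l\<in>L. \<mu> l *\<^sub>R q l) = 0" for \<mu> l
    using that by blast
  have inj: "inj_on q L"
  proof (rule inj_onI, rule ccontr)
    fix l k assume lk: "l \<in> L" "k \<in> L" "q l = q k" "l \<noteq> k"
    let ?\<mu> = "\<lambda>j. unit_fun l j - unit_fun k j"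
    have d: "(\<Sum>j\<in>L. unit_fun a j *\<^sub>R q j) = q a" if "a \<in> L" for a
    proof -
      have "(\<Sum>j\<in>L. unit_fun a j *\<^sub>R q j) = (\<Sum>j\<in>L. if j = a then q j else 0)"
        by (intro sum.cong) (auto simp: unit_fun_def)
      then show ?thesis using that assms(1) by simp
    qed
    have "(\<Sum>j\<in>L. ?\<mu> j *\<^sub>R q j) = 0"
      using d lk by (simp add: scaleR_diff_left sum_subtractf)
    then have "?\<mu> l = 0" by (rule triv[OF lk(1)])
    then show False using lk by (simp add: unit_fun_def)
  qed
  have "independent (q ` L)"
  proof (rule real_vector.independent_if_scalars_zero)
    fix a x assume z: "(\<Sum>x\<in>q ` L. a x *\<^sub>R x) = 0" and "x \<in> q ` L"
    then obtain l where l: "l \<in> L" "x = q l" by blast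
    have "(\<Sum>l\<in>L. a (q l) *\<^sub>R q l) = 0" using z inj by (simp add: sum.reindex)
    then show "a x = 0" unfolding l(2) by (rule triv[OF l(1)])
  qed (use assms in auto)
  moreover have "span (q ` L) = UNIV"
  proof (rule ccontr)
    assume "span (q ` L) \<noteq> UNIV"
    then obtain a where a: "a \<noteq> 0" "span (q ` L) \<subseteq> {x. a \<bullet> x = 0}"
      using span_not_univ_subset_hyperplane by blast
    have "q l \<bullet> a = 0" if "l \<in> L" for l
      using a(2) span_base[OF imageI[OF that], of q] by (auto simp: inner_commute)
    then show False using span a(1) by blast
  qed
  ultimately have "card (q ` L) = DIM(real ^ 'd)"
    by (metis dim_eq_card_independent dim_span dim_UNIV)
  then show False using inj assms(2) by (simp add: card_image)
qed

text \<open>At a fixed placement the stresses form a linear space. Adding a small multiple of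
  \<open>s1\<close> keeps full rank and makes the value at \<open>i\<close> nonzero.\<close>

lemma good_realisation_of_stress:
  assumes G: "looped_simple_graph G" and good: "good_realisation G p q s"
    and s1: "\<And>m. virtual_work G (s1 \<circ> Inl) (s1 \<circ> Inr) p q m = 0" "s1 i \<noteq> 0" and "s i = 0"
  shows "\<exists>s'. good_realisation G p q s' \<and> s' i \<noteq> 0"
proof -
  obtain \<epsilon>0 where \<epsilon>0: "\<epsilon>0 > 0"
    "\<And>\<omega>'. (\<And>e. e \<in> edges G \<Longrightarrow> \<bar>\<omega>' e - (s \<circ> Inl) e\<bar> \<le> \<epsilon>0) \<Longrightarrow> stress_kernel_const G \<omega>'"
    using stress_kernel_const_perturb[OF G, of "s \<circ> Inl"] good
    unfolding good_realisation_def by blast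
  obtain K where K: "K > 0" "\<And>e. e \<in> edges G \<Longrightarrow> \<bar>s1 (Inl e)\<bar> \<le> K"
    using finite_abs_bound[of "edges G" "\<lambda>e. s1 (Inl e)"] graph_finite[OF G] by metis
  define t where "t = \<epsilon>0 / K"
  have t: "t > 0" using K \<epsilon>0 by (simp add: t_def)
  let ?s = "\<lambda>r. s r + t * s1 r"
  have "\<bar>(?s \<circ> Inl) e - (s \<circ> Inl) e\<bar> \<le> \<epsilon>0" if "e \<in> edges G" for e
  proof -
    have "t * \<bar>s1 (Inl e)\<bar> \<le> t * K" using K(2)[OF that] t by (intro mult_left_mono) auto
    moreover have "t * K = \<epsilon>0" using K by (simp add: t_def)
    ultimately show ?thesis using t by (simp add: abs_mult)
  qed
  then have "stress_kernel_const G (?s \<circ> Inl)" by (rule \<epsilon>0(2))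
  moreover have "virtual_work G (?s \<circ> Inl) (?s \<circ> Inr) p q m = 0" for m
    using good s1(1) virtual_work_add_stress[of G "s \<circ> Inl" t "s1 \<circ> Inl" "s \<circ> Inr" "s1 \<circ> Inr" p q m]
    by (simp add: good_realisation_def o_def)
  ultimately have "good_realisation G p q ?s" using good by (simp add: good_realisation_def)
  then show ?thesis using s1(2) t \<open>s i = 0\<close> by (intro exI[of _ ?s]) auto
qed

lemma unit_row_preimage:
  fixes p :: "'v \<Rightarrow> real ^ 'd" and q :: "'l \<Rightarrow> real ^ 'd"
  assumes G: "looped_simple_graph G" and rigid: "rigid_kernel G p q" and i: "i \<in> edges G <+> loops G"
    and zero: "\<And>s. (\<And>m. virtual_work G (s \<circ> Inl) (s \<circ> Inr) p q m = 0) \<Longrightarrow> s i = 0"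
  obtains m where "\<And>e. e \<in> edges G \<Longrightarrow> edge_form p m e = unit_fun i (Inl e)"
      "\<And>l. l \<in> loops G \<Longrightarrow> q l \<bullet> m (lvert G l) = unit_fun i (Inr l)"
proof -
  let ?R = "edges G <+> loops G" and ?C = "verts G \<times> (UNIV :: 'd set)"
  have fin: "finite ?R" "finite ?C" using graph_finite[OF G] by auto
  have tk: "trivial_kernel ?R ?C (rigidity_matrix G p q)"
    using trivial_kernel_rigidity_matrix[OF G] rigid by blast
  have "s i = 0" if "\<And>c. c \<in> ?C \<Longrightarrow> (\<Sum>r\<in>?R. s r * rigidity_matrix G p q r c) = 0" for s
  proof -
    have "\<forall>m. virtual_work G (s \<circ> Inl) (s \<circ> Inr) p q m = 0"
      by (rule virtual_work_eq_0_iff_cokernel[OF G, THEN iffD2]) (use that in blast)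
    then show ?thesis using zero by blast
  qed
  then obtain f where f: "\<forall>r\<in>?R. (\<Sum>c\<in>?C. rigidity_matrix G p q r c * f c) = unit_fun i r"
    using cokernel_zero_imp_preimage[OF fin tk i] by blast
  show ?thesis
  proof (rule that[of "vec_fun f"])
    show "edge_form p (vec_fun f) e = unit_fun i (Inl e)" if "e \<in> edges G" for e
      using rigidity_matrix_edge_row[OF G that, of p q f] f[rule_format, OF InlI[OF that]] by metis
    show "q l \<bullet> vec_fun f (lvert G l) = unit_fun i (Inr l)" if "l \<in> loops G" for l
      using rigidity_matrix_loop_row[OF G that, of p q f] f[rule_format, OF InrI[OF that]] by metis
  qed
qed

text \<open>In the excluded case rigidity makes the loop vectors at the single vertex a basis, so
  only the zero stress exists on the loops, at every rigid placement.\<close>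

lemma good_realisation_nonzero:
  fixes p :: "'v \<Rightarrow> real ^ 'd" and q :: "'l \<Rightarrow> real ^ 'd"
  assumes G: "looped_simple_graph G" and good: "good_realisation G p q s"
    and i: "i \<in> edges G <+> loops G"
    and exc: "\<not> (card (verts G) = 1 \<and> card (loops G) = CARD('d))"
  shows "\<exists>(p' :: 'v \<Rightarrow> real ^ 'd) (q' :: 'l \<Rightarrow> real ^ 'd) s'. good_realisation G p' q' s' \<and> s' i \<noteq> 0"
proof (rule ccontr)
  assume no: "\<not> ?thesis"
  have rigid: "rigid_kernel G p q" using good by (simp add: good_realisation_def)
  have skc: "stress_kernel_const G (s \<circ> Inl)" using good by (simp add: good_realisation_def)
  have si: "s i = 0" using no good by blast
  have "s1 i = 0" if "\<And>m. virtual_work G (s1 \<circ> Inl) (s1 \<circ> Inr) p q m = 0" for s1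
    using good_realisation_of_stress[OF G good that _ si] no by blast
  then obtain m where m: "\<And>e. e \<in> edges G \<Longrightarrow> edge_form p m e = unit_fun i (Inl e)"
      "\<And>l. l \<in> loops G \<Longrightarrow> q l \<bullet> m (lvert G l) = unit_fun i (Inr l)"
    using unit_row_preimage[OF G rigid i] by metis
  \<comment> \<open>Stated for every good stress at \<open>(p, q)\<close>, because the final
    contradiction applies it to a stress other than \<open>s\<close>.\<close>
  have D0: "virtual_work G (s' \<circ> Inl) (s' \<circ> Inr) w r m = 0" if "good_realisation G p q s'" for s' w r
    using good_realisation_nonzero_step[OF G that i m] no by blast
  have mconst: "m u = m v" if "u \<in> verts G" "v \<in> verts G" for u v
  proof (rule stress_kernel_const_vec[OF skc _ that])
    show "(\<Sum>e\<in>edges G. (s \<circ> Inl) e * edge_form w m e) = 0" for w :: "'v \<Rightarrow> real ^ 'd"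
      using D0[OF good, of w "\<lambda>_. 0"] by (simp add: virtual_work_def)
  qed
  have "i \<noteq> Inl e" for e
  proof
    assume ie: "i = Inl e"
    then have e: "e \<in> edges G" using i by auto
    then have sub: "e \<subseteq> verts G" using G by (auto simp: looped_simple_graph_def)
    obtain x y where xy: "e = {x, y}" using graph_edgeE[OF G e] by metis
    then have "m x = m y" using mconst sub by blast
    then have "edge_form p m e = 0" by (simp add: xy edge_form_doubleton)
    then show False using m(1)[OF e] by (simp add: ie unit_fun_def)
  qed
  then obtain l0 where l0: "i = Inr l0" "l0 \<in> loops G" using i by auto
  define c where "c = m (lvert G l0)"
  have mc: "m v = c" if "v \<in> verts G" for v
    unfolding c_def by (rule mconst[OF that graph_lvert[OF G l0(2)]])
  have "q l0 \<bullet> c = 1" using m(2)[OF l0(2)] by (simp add: l0 c_def unit_fun_def)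
  then have c0: "c \<noteq> 0" by auto
  have qc: "q l \<bullet> c = 0" if "l \<in> loops G" "l \<noteq> l0" for l
    using m(2)[OF that(1)] mc graph_lvert[OF G that(1)] that(2) l0(1) by (simp add: unit_fun_def)
  have loops0: "s' (Inr l) = 0" if g: "good_realisation G p q s'" and l: "l \<in> loops G" for s' l
  proof -
    \<comment> \<open>The direction moves only the vector of the loop \<open>l\<close>, by
      \<open>c\<close>, so the pairing isolates \<open>s' (Inr l)\<close> times
      \<open>c \<bullet> c\<close>.\<close>
    have "virtual_work G (s' \<circ> Inl) (s' \<circ> Inr) (\<lambda>_. 0) (\<lambda>k. unit_fun l k *\<^sub>R c) m =
        (\<Sum>k\<in>loops G. s' (Inr k) * (unit_fun l k * (c \<bullet> c)))"
      using graph_lvert[OF G] mc by (simp add: virtual_work_def edge_form_def)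
    also have "\<dots> = (\<Sum>k\<in>loops G. (s' (Inr k) * (c \<bullet> c)) * unit_fun l k)"
      by (simp add: ac_simps)
    also have "\<dots> = s' (Inr l) * (c \<bullet> c)"
      using l graph_finite[OF G] by (simp add: sum_unit_fun)
    finally show ?thesis using D0[OF g] c0 by simp
  qed
  have pconst: "p u = p v" if "u \<in> verts G" "v \<in> verts G" for u v
  proof (rule stress_kernel_const_vec[OF skc _ that])
    show "(\<Sum>e\<in>edges G. (s \<circ> Inl) e * edge_form w p e) = 0" for w :: "'v \<Rightarrow> real ^ 'd"
    proof -
      have "virtual_work G (s \<circ> Inl) (s \<circ> Inr) p q w = 0"
        using good by (simp add: good_realisation_def)
      then show ?thesis
        using loops0[OF good] by (simp add: virtual_work_def edge_form_commute[of w])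
    qed
  qed
  have edges0: "edge_form p w e = 0" if e: "e \<in> edges G" for e and w :: "'v \<Rightarrow> real ^ 'd"
  proof -
    obtain x y where "e = {x, y}" "x \<in> verts G" "y \<in> verts G" using graph_edgeE[OF G e] by metis
    then show ?thesis using pconst[of x y] by (simp add: edge_form_doubleton)
  qed
  have V: "verts G = {lvert G l0}"
  proof (rule ccontr)
    assume "verts G \<noteq> {lvert G l0}"
    then obtain v where v: "v \<in> verts G" "v \<noteq> lvert G l0"
      using graph_lvert[OF G l0(2)] by blast
    \<comment> \<open>Moving only \<open>v\<close> with velocity \<open>c\<close> is an
      infinitesimal motion: the points coincide, so edges impose nothing, and all loops at
      \<open>v\<close> are orthogonal to \<open>c\<close>.\<close>
    have "(\<lambda>x. if x = v then c else 0) v = 0"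
      by (rule rigid_kernelD[OF rigid edges0 _ v(1)]) (use qc v(2) in auto)
    then show False using c0 by simp
  qed
  have E: "edges G = {}"
  proof -
    have False if e: "e \<in> edges G" for e
    proof -
      obtain x y where "x \<noteq> y" "x \<in> verts G" "y \<in> verts G" using graph_edgeE[OF G e] by metis
      then show False using V by simp
    qed
    then show ?thesis by blast
  qed
  have lv: "lvert G l = lvert G l0" if "l \<in> loops G" for l
    using graph_lvert[OF G that] V by simp
  have "card (loops G) \<noteq> CARD('d)" using exc V by simp
  moreover have "x = 0" if "\<And>l. l \<in> loops G \<Longrightarrow> q l \<bullet> x = 0" for x
    using rigid_kernelD[OF rigid, of "\<lambda>_. x" "lvert G l0"] that E V by simp
  ultimately obtain \<mu> l where \<mu>: "l \<in> loops G" "\<mu> l \<noteq> 0" "(\<Sum>l\<in>loops G. \<mu> l *\<^sub>R q l) = 0"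
    using spanning_loops_dependent[OF graph_finite(3)[OF G]] by blast
  \<comment> \<open>On a single vertex the kernel condition is automatic, so this dependence of the
    loop vectors is itself a good stress, although it does not vanish on all loops.\<close>
  define s' :: "'v set + 'l \<Rightarrow> real" where "s' = case_sum (\<lambda>_. 0) \<mu>"
  have "virtual_work G (s' \<circ> Inl) (s' \<circ> Inr) p q w = 0" for w
  proof -
    have "virtual_work G (s' \<circ> Inl) (s' \<circ> Inr) p q w = (\<Sum>l\<in>loops G. \<mu> l *\<^sub>R q l) \<bullet> w (lvert G l0)"
      using lv by (simp add: virtual_work_def E s'_def inner_sum_left)
    then show ?thesis using \<mu> by simp
  qed
  then have "good_realisation G p q s'"
    using rigid V by (simp add: good_realisation_def stress_kernel_const_def)
  then have "s' (Inr l) = 0" using loops0 \<mu>(1) by blast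
  then show False using \<mu>(2) by (simp add: s'_def)
qed

section \<open>General position and 1-extensions\<close>

text \<open>The vectors are chosen one at a time. The span of fewer than the full number has empty
  interior, so every ball around the next target contains a point outside it.\<close>

lemma independent_perturb:
  fixes a :: "'i \<Rightarrow> 'a::euclidean_space"
  assumes "finite Y" "card Y \<le> DIM('a)" "\<epsilon> > 0"
  shows "\<exists>b. (\<forall>z\<in>Y. norm (b z - a z) \<le> \<epsilon>) \<and> inj_on b Y \<and> independent (b ` Y)"
  using assms(1,2)
proof (induction Y)
  case empty
  then show ?case by (simp add: independent_empty)
next
  case (insert z Y)
  then obtain b where b: "\<forall>z\<in>Y. norm (b z - a z) \<le> \<epsilon>" "inj_on b Y" "independent (b ` Y)"
    by auto
  have "dim (span (b ` Y)) \<le> card (b ` Y)"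
    using insert.hyps by (simp add: dim_le_card')
  also have "\<dots> < DIM('a)"
    using insert.hyps insert.prems card_image_le[of Y b] by simp
  finally have "interior (span (b ` Y)) = {}" by (rule empty_interior_lowdim)
  then have "\<not> ball (a z) \<epsilon> \<subseteq> span (b ` Y)"
    using \<open>\<epsilon> > 0\<close> interior_maximal[of "ball (a z) \<epsilon>" "span (b ` Y)"] centre_in_ball[of "a z" \<epsilon>]
    by blast
  then obtain x where x: "x \<in> ball (a z) \<epsilon>" "x \<notin> span (b ` Y)" by blast
  let ?b = "b(z := x)"
  have img: "?b ` insert z Y = insert x (b ` Y)" using insert.hyps by auto
  have "independent (?b ` insert z Y)"
    unfolding img using x b(3) by (simp add: independent_insertI)
  moreover have "x \<notin> b ` Y" using x(2) span_base[of x "b ` Y"] by auto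
  then have "inj_on ?b (insert z Y)"
    using b(2) insert.hyps by (auto simp: inj_on_def)
  moreover have "\<forall>y\<in>insert z Y. norm (?b y - a y) \<le> \<epsilon>"
    using b(1) x(1) insert.hyps by (auto simp: dist_norm norm_minus_commute)
  ultimately show ?case by blast
qed

text \<open>This chooses the vectors of new loops: \<open>B\<close> is extended to a basis, the
  additional basis vectors are assigned to \<open>N\<close>, and a vector orthogonal to a basis is
  zero.\<close>

lemma complete_basis:
  fixes B :: "'a::euclidean_space set"
  assumes "independent B" "finite N" "card B + card N = DIM('a)"
  shows "\<exists>q. \<forall>x. (\<forall>b\<in>B. b \<bullet> x = 0) \<longrightarrow> (\<forall>n\<in>N. q n \<bullet> x = 0) \<longrightarrow> x = 0"
proof -
  obtain C where C: "B \<subseteq> C" "independent C" "UNIV \<subseteq> span C"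
    using maximal_independent_subset_extend[of B UNIV] assms(1) by auto
  have fin: "finite C" "finite B" using C(2) assms(1) by (auto simp: independent_imp_finite)
  have "span C = UNIV" using C(3) by auto
  then have "card C = DIM('a)" using C(2) by (metis dim_eq_card_independent dim_span dim_UNIV)
  then have "card N = card (C - B)" using assms(3) C(1) fin by (simp add: card_Diff_subset)
  then obtain q where q: "bij_betw q N (C - B)"
    using finite_same_card_bij[of N "C - B"] assms(2) fin by auto
  have "x = 0" if "\<forall>b\<in>B. b \<bullet> x = 0" "\<forall>n\<in>N. q n \<bullet> x = 0" for x
  proof -
    have "orthogonal x c" if c: "c \<in> C" for c
    proof (cases "c \<in> B")
      case True
      then show ?thesis using \<open>\<forall>b\<in>B. b \<bullet> x = 0\<close> by (simp add: orthogonal_def inner_commute)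
    next
      case False
      then have "c \<in> q ` N" using q c by (auto simp: bij_betw_def)
      then show ?thesis using \<open>\<forall>n\<in>N. q n \<bullet> x = 0\<close> by (auto simp: orthogonal_def inner_commute)
    qed
    then have "orthogonal x x" using orthogonal_to_span[of x C x] C(3) by auto
    then show ?thesis by (simp add: orthogonal_def)
  qed
  then show ?thesis by blast
qed

section \<open>Adding edges or loops, and adding a vertex\<close>

text \<open>The placement is kept and the stress is extended by zero; further rows can only shrink
  the kernel of the rigidity matrix.\<close>

lemma good_realisation_mono:
  fixes p :: "'v \<Rightarrow> real ^ 'd"
  assumes H: "looped_simple_graph H" and G: "looped_simple_graph G"
    and "verts G = verts H" "edges H \<subseteq> edges G" "loops H \<subseteq> loops G"
    and lv: "\<And>l. l \<in> loops H \<Longrightarrow> lvert G l = lvert H l"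
    and good: "good_realisation H p q s"
  shows "good_realisation G p q (\<lambda>r. if r \<in> edges H <+> loops H then s r else 0)"
proof -
  let ?s = "\<lambda>r. if r \<in> edges H <+> loops H then s r else 0"
  have E: "(\<Sum>e\<in>edges G. (?s \<circ> Inl) e * h e) = (\<Sum>e\<in>edges H. (s \<circ> Inl) e * h e)" for h
    using assms(4) graph_finite[OF G] by (intro sum.mono_neutral_cong_right) auto
  have L: "(\<Sum>l\<in>loops G. (?s \<circ> Inr) l * (q l \<bullet> m (lvert G l))) =
      (\<Sum>l\<in>loops H. (s \<circ> Inr) l * (q l \<bullet> m (lvert H l)))" for m
    using assms(5) lv graph_finite[OF G] by (intro sum.mono_neutral_cong_right) auto
  have "rigid_kernel G p q"
    unfolding rigid_kernel_def
  proof (intro allI impI ballI)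
    fix m u assume m: "\<forall>e\<in>edges G. edge_form p m e = 0" "\<forall>l\<in>loops G. q l \<bullet> m (lvert G l) = 0"
      and u: "u \<in> verts G"
    have "rigid_kernel H p q" using good by (simp add: good_realisation_def)
    then show "m u = 0"
      by (rule rigid_kernelD) (use m u assms(3-5) in \<open>auto simp flip: lv\<close>)
  qed
  moreover have "virtual_work G (?s \<circ> Inl) (?s \<circ> Inr) p q m = 0" for m
    using good unfolding virtual_work_def E L good_realisation_def by blast
  moreover have "stress_kernel_const G (?s \<circ> Inl)"
    using good assms(3) unfolding stress_kernel_const_def stress_form_def E good_realisation_def by simp
  ultimately show ?thesis by (simp add: good_realisation_def)
qed

text \<open>Equilibrium at \<open>v\<close> forces \<open>f v\<close> to be the mean of two old
  values, and for such \<open>f\<close> the new stress form collapses to the old one. The case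
  \<open>x = y\<close>, in which \<open>f v\<close> equals \<open>f x\<close>, serves the loop
  extension.\<close>

lemma stress_kernel_const_extension:
  assumes H: "looped_simple_graph H" and V: "verts G = insert v (verts H)" and v: "v \<notin> verts H"
    and x: "x \<in> verts H" "y \<in> verts H"
    and skc: "stress_kernel_const H \<omega>"
    and coord: "\<And>f. (\<And>g. stress_form G \<omega>' f g = 0) \<Longrightarrow> f v = (f x + f y) / 2"
    and form: "\<And>f g. f v = (f x + f y) / 2 \<Longrightarrow> stress_form G \<omega>' f g = stress_form H \<omega> f g"
  shows "stress_kernel_const G \<omega>'"
  unfolding stress_kernel_const_def
proof (intro allI impI)
  fix f assume z: "\<forall>g. stress_form G \<omega>' f g = 0"
  then have fv: "f v = (f x + f y) / 2" using coord by blast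
  then have "\<forall>g. stress_form H \<omega> f g = 0" using form[OF fv] z by simp
  then have c: "f u = f w" if "u \<in> verts H" "w \<in> verts H" for u w
    using skc that unfolding stress_kernel_const_def by blast
  have "f v = f x" unfolding fv using c[OF x] by simp
  then have "f u = f x" if "u \<in> verts G" for u
    using c[of u x] that x(1) V by auto
  then show "\<forall>u\<in>verts G. \<forall>w\<in>verts G. f u = f w" by metis
qed

text \<open>Evaluates weighted edge sums after the extension: of the new edges at \<open>v\<close>,
  those to \<open>X0\<close> carry the stress \<open>c\<close> and the others carry zero.\<close>

lemma sum_insert_star:
  assumes v: "v \<notin> verts H" and H: "looped_simple_graph H"
    and E0: "E0 \<subseteq> edges H" and X: "finite X" "X0 \<subseteq> X" "v \<notin> X"
  shows "(\<Sum>f\<in>E0 \<union> (\<lambda>z. {v, z}) ` X.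
      (if v \<in> f then if f \<in> (\<lambda>z. {v, z}) ` X0 then c else 0 else \<omega> f) * h f) =
    (\<Sum>f\<in>E0. \<omega> f * h f) + (\<Sum>z\<in>X0. c * h {v, z} :: real)"
proof -
  let ?\<omega> = "\<lambda>f. if v \<in> f then if f \<in> (\<lambda>z. {v, z}) ` X0 then c else 0 else \<omega> f"
  let ?F = "(\<lambda>z. {v, z}) ` X" and ?Fc = "(\<lambda>z. {v, z}) ` X0"
  have vE: "v \<notin> f" if "f \<in> E0" for f
    using that v E0 H by (auto simp: looped_simple_graph_def)
  have inj: "inj_on (\<lambda>z. {v, z}) X0" using X by (auto simp: inj_on_def doubleton_eq_iff)
  have fin: "finite E0" "finite X0" using graph_finite[OF H] E0 X finite_subset by auto
  have "(\<Sum>f\<in>E0 \<union> ?F. ?\<omega> f * h f) = (\<Sum>f\<in>E0. ?\<omega> f * h f) + (\<Sum>f\<in>?F. ?\<omega> f * h f)"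
    using fin vE X by (intro sum.union_disjoint) auto
  moreover have "(\<Sum>f\<in>E0. ?\<omega> f * h f) = (\<Sum>f\<in>E0. \<omega> f * h f)"
    using vE by (intro sum.cong) auto
  moreover have "(\<Sum>f\<in>?F. ?\<omega> f * h f) = (\<Sum>f\<in>?Fc. c * h f)"
    using X fin by (intro sum.mono_neutral_cong_right) auto
  moreover have "(\<Sum>f\<in>?Fc. c * h f) = (\<Sum>z\<in>X0. c * h {v, z})"
    using inj by (simp add: sum.reindex)
  ultimately show ?thesis by simp
qed

lemma edge_form_unit_fun_outside:
  assumes "looped_simple_graph H" "v \<notin> verts H" "e \<in> edges H"
  shows "edge_form f (unit_fun v) e = 0"
proof -
  have "v \<notin> e" using assms by (auto simp: looped_simple_graph_def)
  then show ?thesis by (intro edge_form_const_right[of e _ 0]) (auto simp: unit_fun_def)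
qed

text \<open>With \<open>v\<close> at the midpoint, the edges to \<open>x\<close> and
  \<open>y\<close> replace the deleted edge both as a constraint and as a carrier of stress. A
  motion of \<open>G\<close> is therefore a motion of \<open>H\<close>, hence zero there, and the
  directions at \<open>v\<close>, completed by loop vectors, force \<open>m v = 0\<close>.\<close>

lemma edge_extension:
  fixes p :: "'v \<Rightarrow> real ^ 'd" and q :: "'l \<Rightarrow> real ^ 'd"
  assumes H: "looped_simple_graph H" and G: "looped_simple_graph G"
    and v: "v \<notin> verts H" and VG: "verts G = insert v (verts H)"
    and e: "e \<in> edges H" "e \<subseteq> X" and X: "X \<subseteq> verts H" and N: "N \<inter> loops H = {}"
    and lN: "\<And>l. l \<in> N \<Longrightarrow> lvert G l = v" and lH: "\<And>l. l \<in> loops H \<Longrightarrow> lvert G l = lvert H l"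
    and EG: "edges G = (edges H - {e}) \<union> (\<lambda>z. {v, z}) ` X" and LG: "loops G = loops H \<union> N"
    and card: "card X + card N = CARD('d) + 1"
    and good: "good_realisation H p q s" and se: "s (Inl e) \<noteq> 0"
  shows "\<exists>(p' :: 'v \<Rightarrow> real ^ 'd) (q' :: 'l \<Rightarrow> real ^ 'd) s'. good_realisation G p' q' s'"
proof -
  obtain x y where xy: "e = {x, y}" "x \<noteq> y" "x \<in> verts H" "y \<in> verts H"
    using graph_edgeE[OF H e(1)] by metis
  have xyX: "x \<in> X" "y \<in> X" using e(2) xy by auto
  have finX: "finite X" using X graph_finite[OF H] finite_subset by blast
  have finN: "finite N" using LG graph_finite[OF G] by auto
  have vX: "v \<notin> X" using X v by auto
  \<comment> \<open>Half of the stress as tolerance keeps it nonzero on \<open>e\<close> while the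
    neighbours move into general position.\<close>
  have "\<bar>s (Inl e)\<bar> / 2 > 0" using se by simp
  then obtain \<delta> where \<delta>: "\<delta> > 0" and pert:
    "\<And>p' q'. (\<And>v. v \<in> verts H \<Longrightarrow> norm (p' v - p v) \<le> \<delta>) \<Longrightarrow>
       (\<And>l. l \<in> loops H \<Longrightarrow> norm (q' l - q l) \<le> \<delta>) \<Longrightarrow>
       \<exists>s'. good_realisation H p' q' s' \<and> (\<forall>r\<in>edges H <+> loops H. \<bar>s' r - s r\<bar> \<le> \<bar>s (Inl e)\<bar> / 2)"
    using good_realisation_perturb[OF H good] by metis
  \<comment> \<open>The directions from \<open>v\<close> to \<open>x\<close> and to \<open>y\<close>
    are opposite, so the star at \<open>v\<close> can span only \<open>card X - 1\<close>
    dimensions; the differences to \<open>p1 y\<close> over \<open>Y\<close> count exactly these,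
    leaving \<open>card N\<close> for the loops.\<close>
  define Y where "Y = X - {y}"
  have cY: "card Y + card N = CARD('d)" "finite Y"
    using card finX xyX card_Suc_Diff1[of X y] by (auto simp: Y_def)
  then obtain b where b: "\<forall>z\<in>Y. norm (b z - (p z - p y)) \<le> \<delta>" "inj_on b Y" "independent (b ` Y)"
    using independent_perturb[of Y \<delta> "\<lambda>z. p z - p y"] \<delta> by auto
  define p1 where "p1 z = (if z \<in> Y then b z + p y else p z)" for z
  have b_eq: "b z = p1 z - p1 y" if "z \<in> Y" for z using that by (simp add: p1_def Y_def)
  have "norm (p1 z - p z) \<le> \<delta>" for z
    using b(1) \<delta> by (auto simp: p1_def algebra_simps)
  then obtain s1 where s1: "good_realisation H p1 q s1"
    and "\<forall>r\<in>edges H <+> loops H. \<bar>s1 r - s r\<bar> \<le> \<bar>s (Inl e)\<bar> / 2"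
    using pert[of p1 q] \<delta> by auto
  then have "\<bar>s1 (Inl e) - s (Inl e)\<bar> \<le> \<bar>s (Inl e)\<bar> / 2" using e(1) by blast
  then have s1e: "s1 (Inl e) \<noteq> 0" using se by auto
  have "card (b ` Y) + card N = DIM(real ^ 'd)" using cY b(2) by (simp add: card_image)
  then obtain qN where qN0: "\<forall>x. (\<forall>c\<in>b ` Y. c \<bullet> x = 0) \<longrightarrow> (\<forall>n\<in>N. qN n \<bullet> x = 0) \<longrightarrow> x = 0"
    using complete_basis[OF b(3) finN] by blast
  have qN: "u = 0" if "\<And>z. z \<in> Y \<Longrightarrow> (p1 z - p1 y) \<bullet> u = 0" "\<And>n. n \<in> N \<Longrightarrow> qN n \<bullet> u = 0" for u
    using qN0[rule_format, of u] that b_eq by auto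
  define p' where "p' = p1(v := (1/2) *\<^sub>R (p1 x + p1 y))"
  define q' where "q' l = (if l \<in> N then qN l else q l)" for l
  define \<omega> where "\<omega> = s1 \<circ> Inl"
  \<comment> \<open>Each half of the split edge has half the length, so its stress is doubled to
    transmit the same force.\<close>
  define \<omega>' where "\<omega>' f = (if v \<in> f then if f \<in> (\<lambda>z. {v, z}) ` {x, y} then 2 * \<omega> e else 0 else \<omega> f)" for f
  define s' where "s' = case_sum \<omega>' (\<lambda>l. if l \<in> N then 0 else s1 (Inr l))"
  have s'l: "s' \<circ> Inl = \<omega>'" and s'r: "s' \<circ> Inr = (\<lambda>l. if l \<in> N then 0 else s1 (Inr l))"
    by (auto simp: s'_def)
  have p'H: "p' z = p1 z" if "z \<in> verts H" for z using that v by (auto simp: p'_def)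
  have efH: "edge_form p' m f = edge_form p1 m f" if "f \<in> edges H" for m f
    using that H p'H by (intro edge_form_cong) (auto simp: looped_simple_graph_def)
  have sumG: "(\<Sum>f\<in>edges G. \<omega>' f * h f) =
      (\<Sum>f\<in>edges H - {e}. \<omega> f * h f) + 2 * \<omega> e * (h {v, x} + h {v, y})" for h
    unfolding EG \<omega>'_def using xyX xy(2)
    by (subst sum_insert_star[OF v H _ finX _ vX]) (auto simp: distrib_left)
  have sumH: "(\<Sum>f\<in>edges H. \<omega> f * h f) = (\<Sum>f\<in>edges H - {e}. \<omega> f * h f) + \<omega> e * h e" for h
    using graph_finite[OF H] e(1) by (subst sum.remove[of _ e]) auto
  have form: "2 * (edge_form f g {v, x} + edge_form f g {v, y}) = edge_form f g e"
    if "f v = (1/2) *\<^sub>R (f x + f y)" for f g :: "'v \<Rightarrow> 'a::real_inner"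
  proof -
    have "f v - f x = (1/2) *\<^sub>R (f y - f x)"
      unfolding that by (simp add: algebra_simps flip: scaleR_add_left)
    moreover have "f v - f y = (1/2) *\<^sub>R (f x - f y)"
      unfolding that by (simp add: algebra_simps flip: scaleR_add_left)
    ultimately show ?thesis
      unfolding xy(1) edge_form_doubleton
      by (simp only: inner_scaleR_left inner_diff_left inner_diff_right) (simp add: field_simps)
  qed
  have form': "2 * \<omega> e * (edge_form f g {v, x} + edge_form f g {v, y}) = \<omega> e * edge_form f g e"
    if "f v = (1/2) *\<^sub>R (f x + f y)" for f g :: "'v \<Rightarrow> 'a::real_inner"
    unfolding form[OF that, symmetric] by simp
  have p'v: "p' v = (1/2) *\<^sub>R (p' x + p' y)" using xy v by (auto simp: p'_def)
  have "stress_kernel_const G (s' \<circ> Inl)"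
    unfolding s'l
  proof (rule stress_kernel_const_extension[OF H VG v xy(3,4)])
    show "stress_kernel_const H \<omega>" using s1 by (simp add: good_realisation_def \<omega>_def)
    show "stress_form G \<omega>' f g = stress_form H \<omega> f g" if "f v = (f x + f y) / 2" for f g
      using form'[of f g] that unfolding stress_form_def sumG sumH by simp
    show "f v = (f x + f y) / 2" if "\<And>g. stress_form G \<omega>' f g = 0" for f
    proof -
      have "stress_form G \<omega>' f (unit_fun v) = 2 * \<omega> e * ((f v - f x) + (f v - f y))"
        using edge_form_unit_fun_outside[OF H v] xy(3,4) v
        unfolding stress_form_def sumG by (auto simp: edge_form_doubleton unit_fun_def)
      then show ?thesis using that[of "unit_fun v"] s1e by (simp add: \<omega>_def)
    qed
  qed
  moreover have "virtual_work G (s' \<circ> Inl) (s' \<circ> Inr) p' q' m = 0" for m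
  proof -
    have "(\<Sum>f\<in>edges G. \<omega>' f * edge_form p' m f) = (\<Sum>f\<in>edges H. \<omega> f * edge_form p' m f)"
      unfolding sumG sumH using form'[OF p'v, of m] by simp
    also have "\<dots> = (\<Sum>f\<in>edges H. \<omega> f * edge_form p1 m f)" using efH by simp
    finally have "(\<Sum>f\<in>edges G. \<omega>' f * edge_form p' m f) = (\<Sum>f\<in>edges H. \<omega> f * edge_form p1 m f)" .
    moreover have "(\<Sum>l\<in>loops G. (s' \<circ> Inr) l * (q' l \<bullet> m (lvert G l))) =
        (\<Sum>l\<in>loops H. (s1 \<circ> Inr) l * (q l \<bullet> m (lvert H l)))"
      unfolding s'r using LG N lH graph_finite[OF G]
      by (intro sum.mono_neutral_cong_right) (auto simp: q'_def)
    ultimately show ?thesis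
      using s1 unfolding virtual_work_def s'l good_realisation_def \<omega>_def by simp
  qed
  moreover have "rigid_kernel G p' q'"
    unfolding rigid_kernel_def
  proof (intro allI impI)
    fix m assume mE: "\<forall>f\<in>edges G. edge_form p' m f = 0"
      and mL: "\<forall>l\<in>loops G. q' l \<bullet> m (lvert G l) = 0"
    have star: "edge_form p' m {v, z} = 0" if "z \<in> X" for z using mE EG that by auto
    have mH: "m u = 0" if u: "u \<in> verts H" for u
    proof (rule rigid_kernelD[OF _ _ _ u])
      show "rigid_kernel H p1 q" using s1 by (simp add: good_realisation_def)
      show "edge_form p1 m f = 0" if f: "f \<in> edges H" for f
      proof (cases "f = e")
        case True
        then show ?thesis using form[OF p'v, of m] star xyX efH[OF f, of m] by simp
      next
        case False
        then show ?thesis using mE EG efH[OF f, of m] f by simp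
      qed
      show "q l \<bullet> m (lvert H l) = 0" if l: "l \<in> loops H" for l
      proof -
        have "q' l \<bullet> m (lvert G l) = 0" using mL LG l by blast
        moreover have "l \<notin> N" using N l by blast
        ultimately show ?thesis using lH[OF l] by (simp add: q'_def)
      qed
    qed
    have "m v = 0"
    proof (rule qN)
      fix z assume z: "z \<in> Y"
      have "(p' v - p1 z) \<bullet> m v = 0" if "z \<in> X" for z
        using star[OF that] mH[of z] p'H[of z] that X by (auto simp: edge_form_doubleton)
      from this[of z] this[of y] show "(p1 z - p1 y) \<bullet> m v = 0"
        using z xyX by (simp add: Y_def inner_diff_left)
    next
      show "qN n \<bullet> m v = 0" if n: "n \<in> N" for n
      proof -
        have "q' n \<bullet> m (lvert G n) = 0" using mL LG n by blast
        then show ?thesis using n lN[OF n] by (simp add: q'_def)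
      qed
    qed
    then show "\<forall>u\<in>verts G. m u = 0" using mH VG by auto
  qed
  ultimately have "good_realisation G p' q' s'" by (simp add: good_realisation_def)
  then show ?thesis by blast
qed

text \<open>The point \<open>v\<close> is the tip of the loop vector \<open>b x\<close> at
  \<open>x\<close>, and a new loop \<open>n0\<close> at \<open>v\<close> gets the same vector. The
  edge from \<open>v\<close> to \<open>x\<close> then carries the force of the deleted loop over to
  \<open>n0\<close>. Conversely the constraints of \<open>n0\<close> and of this edge together imply
  that of the deleted loop.\<close>

lemma loop_extension:
  fixes p :: "'v \<Rightarrow> real ^ 'd" and q :: "'l \<Rightarrow> real ^ 'd"
  assumes H: "looped_simple_graph H" and G: "looped_simple_graph G"
    and v: "v \<notin> verts H" and VG: "verts G = insert v (verts H)"
    and e: "e \<in> loops H" "lvert H e \<in> X" and X: "X \<subseteq> verts H" and N: "N \<inter> loops H = {}" "N \<noteq> {}"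
    and lN: "\<And>l. l \<in> N \<Longrightarrow> lvert G l = v"
    and lH: "\<And>l. l \<in> loops H - {e} \<Longrightarrow> lvert G l = lvert H l"
    and EG: "edges G = edges H \<union> (\<lambda>z. {v, z}) ` X" and LG: "loops G = (loops H - {e}) \<union> N"
    and card: "card X + card N = CARD('d) + 1"
    and good: "good_realisation H p q s" and se: "s (Inr e) \<noteq> 0"
  shows "\<exists>(p' :: 'v \<Rightarrow> real ^ 'd) (q' :: 'l \<Rightarrow> real ^ 'd) s'. good_realisation G p' q' s'"
proof -
  define x where "x = lvert H e"
  have x: "x \<in> verts H" "x \<in> X" using e X by (auto simp: x_def)
  obtain n0 where n0: "n0 \<in> N" using N by blast
  have finX: "finite X" using X graph_finite[OF H] finite_subset by blast
  have finN: "finite N" using LG graph_finite[OF G] by auto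
  have vX: "v \<notin> X" using X v by auto
  have eN: "e \<notin> N" using N e by auto
  have "\<bar>s (Inr e)\<bar> / 2 > 0" using se by simp
  then obtain \<delta> where \<delta>: "\<delta> > 0" and pert:
    "\<And>p' q'. (\<And>v. v \<in> verts H \<Longrightarrow> norm (p' v - p v) \<le> \<delta>) \<Longrightarrow>
       (\<And>l. l \<in> loops H \<Longrightarrow> norm (q' l - q l) \<le> \<delta>) \<Longrightarrow>
       \<exists>s'. good_realisation H p' q' s' \<and> (\<forall>r\<in>edges H <+> loops H. \<bar>s' r - s r\<bar> \<le> \<bar>s (Inr e)\<bar> / 2)"
    using good_realisation_perturb[OF H good] by metis
  have cX: "card X + card (N - {n0}) = CARD('d)"
    using card finN n0 card_Suc_Diff1[of N n0] by auto
  \<comment> \<open>The target at \<open>x\<close> is the deleted loop vector itself, so it becomes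
    independent together with the differences to the other neighbours.\<close>
  then obtain b where b: "\<forall>z\<in>X. norm (b z - (if z = x then q e else p z - p x)) \<le> \<delta>"
      "inj_on b X" "independent (b ` X)"
    using independent_perturb[of X \<delta> "\<lambda>z. if z = x then q e else p z - p x"] \<delta> finX by auto
  define p1 where "p1 z = (if z \<in> X - {x} then b z + p x else p z)" for z
  define q1 where "q1 = q(e := b x)"
  have b_eq: "b z = p1 z - p1 x" if "z \<in> X" "z \<noteq> x" for z using that by (simp add: p1_def)
  have "norm (p1 z - p z) \<le> \<delta>" for z
    using b(1) \<delta> by (auto simp: p1_def algebra_simps)
  moreover have "norm (q1 l - q l) \<le> \<delta>" for l
    using b(1) \<delta> x by (auto simp: q1_def)
  ultimately obtain s1 where s1: "good_realisation H p1 q1 s1"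
    and "\<forall>r\<in>edges H <+> loops H. \<bar>s1 r - s r\<bar> \<le> \<bar>s (Inr e)\<bar> / 2"
    using pert[of p1 q1] by auto
  then have "\<bar>s1 (Inr e) - s (Inr e)\<bar> \<le> \<bar>s (Inr e)\<bar> / 2" using e(1) by blast
  then have s1e: "s1 (Inr e) \<noteq> 0" using se by auto
  have "card (b ` X) + card (N - {n0}) = DIM(real ^ 'd)" using cX b(2) by (simp add: card_image)
  then obtain qN where qN0: "\<forall>x. (\<forall>c\<in>b ` X. c \<bullet> x = 0) \<longrightarrow> (\<forall>n\<in>N - {n0}. qN n \<bullet> x = 0) \<longrightarrow> x = 0"
    using complete_basis[OF b(3) finite_Diff[OF finN]] by blast
  have qN: "u = 0" if "\<And>z. z \<in> X \<Longrightarrow> b z \<bullet> u = 0" "\<And>n. n \<in> N - {n0} \<Longrightarrow> qN n \<bullet> u = 0" for u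
    using qN0[rule_format, of u] that by blast
  define p' where "p' = p1(v := p1 x + b x)"
  define q' where "q' l = (if l = n0 then b x else if l \<in> N then qN l else q1 l)" for l
  define \<omega> where "\<omega> = s1 \<circ> Inl"
  \<comment> \<open>The minus sign comes from \<open>b x \<bullet> m x = b x \<bullet> m v - b x
    \<bullet> (m v - m x)\<close>: the first term is the work at \<open>n0\<close>, the second that
    of the new edge.\<close>
  define \<omega>' where "\<omega>' f = (if v \<in> f then if f \<in> (\<lambda>z. {v, z}) ` {x} then - s1 (Inr e) else 0 else \<omega> f)" for f
  define \<mu>' where "\<mu>' l = (if l = n0 then s1 (Inr e) else if l \<in> N then 0 else s1 (Inr l))" for l
  define s' where "s' = case_sum \<omega>' \<mu>'"
  have s'l: "s' \<circ> Inl = \<omega>'" and s'r: "s' \<circ> Inr = \<mu>'"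
    by (auto simp: s'_def)
  have p'H: "p' z = p1 z" if "z \<in> verts H" for z using that v by (auto simp: p'_def)
  have efH: "edge_form p' m f = edge_form p1 m f" if "f \<in> edges H" for m f
    using that H p'H by (intro edge_form_cong) (auto simp: looped_simple_graph_def)
  have sumG: "(\<Sum>f\<in>edges G. \<omega>' f * h f) = (\<Sum>f\<in>edges H. \<omega> f * h f) - s1 (Inr e) * h {v, x}" for h
    unfolding EG \<omega>'_def using x
    by (subst sum_insert_star[OF v H _ finX _ vX]) auto
  have p'x: "p' v - p' x = b x" using x v by (auto simp: p'_def)
  have "stress_kernel_const G (s' \<circ> Inl)"
    unfolding s'l
  proof (rule stress_kernel_const_extension[OF H VG v x(1) x(1)])
    show "stress_kernel_const H \<omega>" using s1 by (simp add: good_realisation_def \<omega>_def)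
    show "stress_form G \<omega>' f g = stress_form H \<omega> f g" if "f v = (f x + f x) / 2" for f g
      using that unfolding stress_form_def sumG by (simp add: edge_form_doubleton)
    show "f v = (f x + f x) / 2" if "\<And>g. stress_form G \<omega>' f g = 0" for f
    proof -
      have "stress_form G \<omega>' f (unit_fun v) = - s1 (Inr e) * (f v - f x)"
        using edge_form_unit_fun_outside[OF H v] x v
        unfolding stress_form_def sumG by (auto simp: edge_form_doubleton unit_fun_def)
      then show ?thesis using that[of "unit_fun v"] s1e by simp
    qed
  qed
  moreover have "virtual_work G (s' \<circ> Inl) (s' \<circ> Inr) p' q' m = 0" for m
  proof -
    have E: "(\<Sum>f\<in>edges G. \<omega>' f * edge_form p' m f) =
        (\<Sum>f\<in>edges H. \<omega> f * edge_form p1 m f) - s1 (Inr e) * (b x \<bullet> (m v - m x))"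
      unfolding sumG using efH p'x by (simp add: edge_form_doubleton)
    have "(\<Sum>l\<in>loops G. \<mu>' l * (q' l \<bullet> m (lvert G l))) =
        (\<Sum>l\<in>loops H - {e}. \<mu>' l * (q' l \<bullet> m (lvert G l))) + (\<Sum>l\<in>N. \<mu>' l * (q' l \<bullet> m (lvert G l)))"
      unfolding LG using finN graph_finite[OF H] N by (intro sum.union_disjoint) auto
    also have "(\<Sum>l\<in>N. \<mu>' l * (q' l \<bullet> m (lvert G l))) = (\<Sum>l\<in>{n0}. s1 (Inr e) * (b x \<bullet> m v))"
      using n0 finN lN by (intro sum.mono_neutral_cong_right) (auto simp: \<mu>'_def q'_def)
    also have "(\<Sum>l\<in>loops H - {e}. \<mu>' l * (q' l \<bullet> m (lvert G l))) =
        (\<Sum>l\<in>loops H - {e}. s1 (Inr l) * (q1 l \<bullet> m (lvert H l)))"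
      using n0 N lH by (intro sum.cong) (auto simp: \<mu>'_def q'_def)
    finally have L: "(\<Sum>l\<in>loops G. \<mu>' l * (q' l \<bullet> m (lvert G l))) =
        (\<Sum>l\<in>loops H - {e}. s1 (Inr l) * (q1 l \<bullet> m (lvert H l))) + s1 (Inr e) * (b x \<bullet> m v)" by simp
    have LH: "(\<Sum>l\<in>loops H. s1 (Inr l) * (q1 l \<bullet> m (lvert H l))) =
        s1 (Inr e) * (b x \<bullet> m x) + (\<Sum>l\<in>loops H - {e}. s1 (Inr l) * (q1 l \<bullet> m (lvert H l)))"
      using graph_finite[OF H] e(1) by (subst sum.remove[of _ e]) (auto simp: q1_def x_def)
    have "virtual_work H (s1 \<circ> Inl) (s1 \<circ> Inr) p1 q1 m = 0"
      using s1 by (simp add: good_realisation_def)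
    then show ?thesis
      unfolding virtual_work_def s'l s'r E L using LH
      by (simp add: \<omega>_def inner_diff_right right_diff_distrib)
  qed
  moreover have "rigid_kernel G p' q'"
    unfolding rigid_kernel_def
  proof (intro allI impI)
    fix m assume mE: "\<forall>f\<in>edges G. edge_form p' m f = 0"
      and mL: "\<forall>l\<in>loops G. q' l \<bullet> m (lvert G l) = 0"
    have star: "edge_form p' m {v, z} = 0" if "z \<in> X" for z using mE EG that by auto
    have "q' n0 \<bullet> m (lvert G n0) = 0" using mL LG n0 by blast
    then have bv: "b x \<bullet> m v = 0" using lN[OF n0] by (simp add: q'_def)
    then have bx: "b x \<bullet> m x = 0"
      using star[OF x(2)] p'x by (simp add: edge_form_doubleton inner_diff_right)
    have mH: "m u = 0" if u: "u \<in> verts H" for u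
    proof (rule rigid_kernelD[OF _ _ _ u])
      show "rigid_kernel H p1 q1" using s1 by (simp add: good_realisation_def)
      show "edge_form p1 m f = 0" if f: "f \<in> edges H" for f
        using mE EG efH[OF f, of m] f by simp
      show "q1 l \<bullet> m (lvert H l) = 0" if l: "l \<in> loops H" for l
      proof (cases "l = e")
        case True
        then show ?thesis using bx by (simp add: q1_def x_def)
      next
        case False
        then have "l \<in> loops G" "l \<notin> N" "lvert G l = lvert H l" using l LG N lH by auto
        moreover have "q' l \<bullet> m (lvert G l) = 0" using mL \<open>l \<in> loops G\<close> by blast
        moreover have "l \<noteq> n0" using n0 \<open>l \<notin> N\<close> by blast
        ultimately show ?thesis by (simp add: q'_def)
      qed
    qed
    have "m v = 0"
    proof (rule qN)
      fix z assume z: "z \<in> X"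
      \<comment> \<open>For \<open>z\<close> other than \<open>x\<close> the vector
        \<open>p' v - p1 z\<close> equals \<open>b x - b z\<close>, so together with
        \<open>n0\<close> the star edges make every \<open>b z\<close> orthogonal to
        \<open>m v\<close>.\<close>
      have "(p' v - p1 z) \<bullet> m v = 0" if "z \<in> X" for z
        using star[OF that] mH[of z] p'H[of z] that X by (auto simp: edge_form_doubleton)
      from this[OF z] this[OF x(2)] show "b z \<bullet> m v = 0"
        using z bv b_eq[OF z] by (cases "z = x") (simp_all add: inner_diff_left)
    next
      show "qN n \<bullet> m v = 0" if n: "n \<in> N - {n0}" for n
      proof -
        have "q' n \<bullet> m (lvert G n) = 0" using mL LG n by blast
        then show ?thesis using n lN[of n] by (simp add: q'_def)
      qed
    qed
    then show "\<forall>u\<in>verts G. m u = 0" using mH VG by auto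
  qed
  ultimately have "good_realisation G p' q' s'" by (simp add: good_realisation_def)
  then show ?thesis by blast
qed

section \<open>From the graph operations to the theorem\<close>

text \<open>Edges are two-element sets, so the new edges correspond bijectively to their far ends;
  the extension lemmas work with these ends.\<close>

lemma star_neighbours:
  assumes G: "looped_simple_graph G" and VG: "verts G = insert v V" and v: "v \<notin> V"
    and F: "F \<subseteq> edges G" "\<And>f. f \<in> F \<Longrightarrow> v \<in> f"
  obtains X where "X \<subseteq> V" "F = (\<lambda>z. {v, z}) ` X" "card X = card F"
proof -
  define X where "X = {z. {v, z} \<in> F}"
  have XV: "X \<subseteq> V"
  proof
    fix z assume "z \<in> X"
    then have "{v, z} \<in> edges G" using F(1) by (auto simp: X_def)
    then have "card {v, z} = 2" "{v, z} \<subseteq> verts G" using G by (auto simp: looped_simple_graph_def)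
    then show "z \<in> V" using VG by (cases "z = v") auto
  qed
  have FX: "F = (\<lambda>z. {v, z}) ` X"
  proof (intro set_eqI iffI)
    fix f assume f: "f \<in> F"
    then have fE: "f \<in> edges G" using F(1) by blast
    obtain a b where ab: "f = {a, b}" using graph_edgeE[OF G fE] by metis
    then have "f = {v, a} \<or> f = {v, b}" using F(2)[OF f] by (auto simp: insert_commute)
    then show "f \<in> (\<lambda>z. {v, z}) ` X" using f by (auto simp: X_def)
  qed (auto simp: X_def)
  have "inj_on (\<lambda>z. {v, z}) X" by (auto simp: inj_on_def doubleton_eq_iff)
  then have "card X = card F" unfolding FX by (simp add: card_image)
  then show ?thesis using that XV FX by blast
qed

lemma good_realisation_iff:
  fixes p :: "'v \<Rightarrow> real ^ 'd"
  assumes "looped_simple_graph G" "verts G \<noteq> {}"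
  shows "infinitesimally_rigid G p q \<and> equilibrium_stress G p q \<omega> \<mu> \<and> full_rank_stress G \<omega> \<longleftrightarrow>
    good_realisation G p q (case_sum \<omega> \<mu>)"
proof -
  have "case_sum \<omega> \<mu> \<circ> Inl = \<omega>" "case_sum \<omega> \<mu> \<circ> Inr = \<mu>" by auto
  then show ?thesis
    unfolding good_realisation_def
    using infinitesimally_rigid_iff[OF assms(1), of p q] equilibrium_stress_iff[OF assms(1), of p q \<omega> \<mu>]
      full_rank_stress_iff[OF assms(1), of \<omega>] assms(2) by simp
qed

lemma good_realisation_one_extension:
  fixes p :: "'v \<Rightarrow> real ^ 'd" and q :: "'l \<Rightarrow> real ^ 'd"
  assumes ext: "one_extension CARD('d) H G"
    and exc: "\<not> (card (verts H) = 1 \<and> card (loops H) = CARD('d))"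
    and good: "good_realisation H p q s"
  shows "\<exists>(p' :: 'v \<Rightarrow> real ^ 'd) (q' :: 'l \<Rightarrow> real ^ 'd) s'. good_realisation G p' q' s'"
proof -
  have H: "looped_simple_graph H" and G: "looped_simple_graph G"
    using ext by (auto simp: one_extension_def)
  obtain v F N where v: "v \<notin> verts H" "verts G = insert v (verts H)"
    and F: "\<forall>f\<in>F. v \<in> f" and N: "N \<inter> loops H = {}" "\<forall>l\<in>N. lvert G l = v"
    and card: "card F + card N = CARD('d) + 1"
    and lH: "\<forall>l\<in>loops G - N. lvert G l = lvert H l"
    and cases: "(\<exists>e\<in>edges H. edges G = (edges H - {e}) \<union> F \<and> loops G = loops H \<union> N \<and>
            (\<forall>x\<in>e. \<exists>!f. f \<in> F \<and> x \<in> f)) \<or>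
         (\<exists>e\<in>loops H. edges G = edges H \<union> F \<and> loops G = (loops H - {e}) \<union> N \<and>
            (\<exists>!f. f \<in> F \<and> lvert H e \<in> f) \<and> N \<noteq> {})"
    using ext unfolding one_extension_def by (elim conjE exE) (rule that; assumption)
  have "F \<subseteq> edges G" using cases by auto
  then obtain X where X: "X \<subseteq> verts H" "F = (\<lambda>z. {v, z}) ` X" "card X = card F"
    using star_neighbours[OF G v(2,1), of F] F by metis
  have inX: "x \<in> X" if "x \<in> verts H" "f \<in> F" "x \<in> f" for x f
    using that v(1) X(2) by auto
  from cases show ?thesis
  proof
    assume "\<exists>e\<in>edges H. edges G = (edges H - {e}) \<union> F \<and> loops G = loops H \<union> N \<and>
            (\<forall>x\<in>e. \<exists>!f. f \<in> F \<and> x \<in> f)"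
    then obtain e where e: "e \<in> edges H" "edges G = (edges H - {e}) \<union> F" "loops G = loops H \<union> N"
      "\<forall>x\<in>e. \<exists>!f. f \<in> F \<and> x \<in> f" by blast
    have eX: "e \<subseteq> X"
    proof
      fix x assume x: "x \<in> e"
      then obtain f where "f \<in> F" "x \<in> f" using e(4) by blast
      moreover have "x \<in> verts H" using x e(1) H by (auto simp: looped_simple_graph_def)
      ultimately show "x \<in> X" using inX by blast
    qed
    obtain p1 :: "'v \<Rightarrow> real ^ 'd" and q1 :: "'l \<Rightarrow> real ^ 'd" and s1
      where g: "good_realisation H p1 q1 s1" "s1 (Inl e) \<noteq> 0"
      using good_realisation_nonzero[OF H good InlI[OF e(1)] exc] by blast
    show ?thesis
      by (rule edge_extension[OF H G v e(1) eX X(1) N(1) _ _ _ e(3) _ g])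
        (use N lH e X card in auto)
  next
    assume "\<exists>e\<in>loops H. edges G = edges H \<union> F \<and> loops G = (loops H - {e}) \<union> N \<and>
            (\<exists>!f. f \<in> F \<and> lvert H e \<in> f) \<and> N \<noteq> {}"
    then obtain e where e: "e \<in> loops H" "edges G = edges H \<union> F" "loops G = (loops H - {e}) \<union> N"
      "\<exists>!f. f \<in> F \<and> lvert H e \<in> f" "N \<noteq> {}" by (elim bexE conjE) (rule that; assumption)
    obtain f where "f \<in> F" "lvert H e \<in> f" using e(4) by (elim ex1E) blast
    then have eX: "lvert H e \<in> X" by (rule inX[OF graph_lvert[OF H e(1)]])
    obtain p1 :: "'v \<Rightarrow> real ^ 'd" and q1 :: "'l \<Rightarrow> real ^ 'd" and s1
      where g: "good_realisation H p1 q1 s1" "s1 (Inr e) \<noteq> 0"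
      using good_realisation_nonzero[OF H good InrI[OF e(1)] exc] by blast
    show ?thesis
      by (rule loop_extension[OF H G v e(1) eX X(1) N(1) e(5) _ _ _ e(3) _ g])
        (use N lH e X card in auto)
  qed
qed

text \<open>The third hypothesis excludes a genuine counterexample. One vertex with
  \<open>CARD('d)\<close> loops is rigid for a basis of loop vectors, and the zero stress has full
  rank there. Its 1-extension has two vertices, one edge and \<open>2 * CARD('d) - 1\<close> loops,
  so a rigid realisation has independent rows and only the zero stress, which is not of full rank on
  two vertices.\<close>

theorem theorem4p7:
  fixes H G :: "('v, 'l) looped_graph"
  assumes "looped_simple_graph H"
    and "adds_edge H G \<or> adds_loop H G \<or> one_extension CARD('d) H G"
    and "one_extension CARD('d) H G \<Longrightarrow> \<not> (card (verts H) = 1 \<and> card (loops H) = CARD('d))"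
    and "\<exists>(p :: 'v \<Rightarrow> real ^ 'd::finite) (q :: 'l \<Rightarrow> real ^ 'd) \<omega> \<mu>.
           infinitesimally_rigid H p q \<and> equilibrium_stress H p q \<omega> \<mu> \<and> full_rank_stress H \<omega>"
  shows "\<exists>(p :: 'v \<Rightarrow> real ^ 'd) (q :: 'l \<Rightarrow> real ^ 'd) \<omega> \<mu>.
           infinitesimally_rigid G p q \<and> equilibrium_stress G p q \<omega> \<mu> \<and> full_rank_stress G \<omega>"
proof -
  obtain p :: "'v \<Rightarrow> real ^ 'd" and q :: "'l \<Rightarrow> real ^ 'd" and \<omega> \<mu>
    where H: "infinitesimally_rigid H p q \<and> equilibrium_stress H p q \<omega> \<mu> \<and> full_rank_stress H \<omega>"
    using assms(4) by blast
  have VH: "verts H \<noteq> {}" using H full_rank_stress_iff[OF assms(1)] by blast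
  have good: "good_realisation H p q (case_sum \<omega> \<mu>)"
    using good_realisation_iff[OF assms(1) VH, THEN iffD1, OF H] .
  have "\<exists>(p' :: 'v \<Rightarrow> real ^ 'd) (q' :: 'l \<Rightarrow> real ^ 'd) s'. good_realisation G p' q' s'"
    using assms(2)
  proof (elim disjE)
    assume "adds_edge H G"
    then have "looped_simple_graph G" "verts G = verts H" "edges H \<subseteq> edges G" "loops H \<subseteq> loops G"
      "\<And>l. l \<in> loops H \<Longrightarrow> lvert G l = lvert H l" by (auto simp: adds_edge_def)
    then show ?thesis
      using good_realisation_mono[OF assms(1) _ _ _ _ _ good, of G] by blast
  next
    assume "adds_loop H G"
    then have "looped_simple_graph G" "verts G = verts H" "edges H \<subseteq> edges G" "loops H \<subseteq> loops G"
      "\<And>l. l \<in> loops H \<Longrightarrow> lvert G l = lvert H l" by (auto simp: adds_loop_def)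
    then show ?thesis
      using good_realisation_mono[OF assms(1) _ _ _ _ _ good, of G] by blast
  next
    assume ext: "one_extension CARD('d) H G"
    show ?thesis by (rule good_realisation_one_extension[OF ext assms(3)[OF ext] good])
  qed
  then obtain p' :: "'v \<Rightarrow> real ^ 'd" and q' :: "'l \<Rightarrow> real ^ 'd" and s'
    where "good_realisation G p' q' s'" by blast
  moreover have "s' = case_sum (s' \<circ> Inl) (s' \<circ> Inr)"
    by (auto simp: fun_eq_iff split: sum.split)
  moreover have "looped_simple_graph G" "verts G \<noteq> {}"
    using assms(2) VH by (auto simp: adds_edge_def adds_loop_def one_extension_def)
  ultimately show ?thesis using good_realisation_iff[of G p' q' "s' \<circ> Inl" "s' \<circ> Inr"] by auto
qed

end
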